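(* Let $v:\mathbb X\times\mathbb X\to[0,\infty]$ be a measurable symmetric pair potential and $z:\mathbb X\to[0,\infty)$ measurable with $\int_B z\,d\lambda<\infty$ for all $B\in\mathcal X_{\mathsf b}$. Suppose there exists a measurable $a:\mathbb X\to[0,\infty)$ such that for $\lambda$-almost all $x_0\in\mathbb X$, $$\sum_{k=1}^\infty\frac{1}{k!}\int_{\mathbb X^k}\prod_{j=1}^k|f(x_0,y_j)|\prod_{1\le i<j\le k}\bigl(1+f(y_i,y_j)\bigr)\prod_{j=1}^k z(y_j)e^{a(y_j)}\,d\lambda^k(\mathbf y)\le e^{a(x_0)}-1.$$ Then for all $n\in\mathbb N$ and $\lambda^n$-almost all $(x_1,\dots,x_n)\in\mathbb X^n$, $$|\psi_{n,n}(x_1,\dots,x_n)|+\sum_{k=1}^\infty\frac{1}{k!}\int_{\mathbb X^k}|\psi_{n,n+k}(x_1,\dots,x_n,y_1,\dots,y_k)|\,d\lambda_z^k(\mathbf y)\le\prod_{1\le i<j\le n}\bigl(1+f(x_i,x_j)\bigr)e^{\sum_{i=1}^na(x_i)},$$ and for every $\Lambda\in\mathcal X_{\mathsf b}$ with $\lambda_z(\Lambda)>0$ the correlation functions $\rho_{n,\Lambda}$ of $\mathsf P_\Lambda$ satisfy, for $\lambda^n$-almost all $(x_1,\dots,x_n)\in\Lambda^n$, $$\rho_{n,\Lambda}(x_1,\dots,x_n)=\prod_{j=1}^nz(x_j)\Bigl(\psi_{n,n}(x_1,\dots,x_n)+\sum_{k=1}^\infty\frac1{k!}\int_{\Lambda^k}\psi_{n,n+k}(x_1,\dots,x_n,y_1,\dots,y_k)\,d\lambda_z^k(\mathbf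 y)\Bigr).$$
   Context: $(\mathbb X,\mathrm{dist})$ is a complete separable metric space with Borel $\sigma$-algebra $\mathcal X$, $\mathcal X_{\mathsf b}$ the bounded Borel sets, $\lambda$ a measure finite on bounded sets; $\lambda_z(dx)=z(x)\lambda(dx)$; $f(x,y)=e^{-v(x,y)}-1$ (with $e^{-\infty}=0$). For bounded $\Lambda$ with $\lambda_z(\Lambda)>0$, $\mathsf P_\Lambda$ is the finite-volume Gibbs measure with empty boundary conditions: the probability measure on counting measures supported in $\Lambda$ that is absolutely continuous w.r.t. the Poisson point process with intensity $\mathbf 1_\Lambda\lambda_z$ with density proportional to $\eta=\sum_{i=1}^n\delta_{x_i}\mapsto e^{-\sum_{1\le i<j\le n}v(x_i,x_j)}$. Its correlation functions $\rho_{n,\Lambda}$ are the densities w.r.t. $\lambda^n$ of its factorial moment measures, i.e. $\mathsf E_\Lambda[\int g\,d\eta^{(n)}]=\int g\rho_{n,\Lambda}\,d\lambda^n$ for measurable $g\ge0$, where $\eta^{(n)}$ is the $n$-th factorial measure ($\int g\,d\eta^{(n)}$ is the sum of $g(x_{i_1},\dots,x_{i_n})$ over pairwise distinct indices). For $k\le n$, $\mathcal D_{k,n}$ is the set of simple graphs on $\{1,\dots,n\}$ in which every vertex in $\{k+1,\dots,n\}$ is joined by a path to some vertex of $\{1,\dots,k\}$, and $\psi_{k,n}(x_1,\dots,x_n)=\sum_{G\in\mathcal D_{k,n}}\prod_{\{i,j\}\in E(G)}f(x_i,x_j)$. *)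

theory Defs
  imports "HOL-Probability.Probability"
begin

text \<open>Mayer function f(x,y) = exp(-v(x,y)) - 1, with exp(-infinity) = 0.\<close>
definition mayer :: "('a \<Rightarrow> 'a \<Rightarrow> ennreal) \<Rightarrow> 'a \<Rightarrow> 'a \<Rightarrow> real" where
  "mayer v x y = (if v x y = \<infinity> then 0 else exp (- enn2real (v x y))) - 1"

text \<open>Points of X^n are functions on {..<n} (0-based indices), as elements of PiM {..<n}.\<close>
definition lamz :: "'a measure \<Rightarrow> ('a \<Rightarrow> real) \<Rightarrow> 'a measure" where
  "lamz lam z = density lam (\<lambda>x. ennreal (z x))"

definition lamzL :: "'a measure \<Rightarrow> ('a \<Rightarrow> real) \<Rightarrow> 'a set \<Rightarrow> 'a measure" where
  "lamzL lam z L = density lam (\<lambda>x. ennreal (z x) * indicator L x)"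

text \<open>Concatenation (x_1..x_n, y_1..y_k).\<close>
definition app :: "nat \<Rightarrow> (nat \<Rightarrow> 'a) \<Rightarrow> (nat \<Rightarrow> 'a) \<Rightarrow> nat \<Rightarrow> 'a" where
  "app n x y = (\<lambda>i. if i < n then x i else y (i - n))"

text \<open>Simple graphs on {0..<n}: sets of 2-element subsets.\<close>
definition graph_rel :: "nat set set \<Rightarrow> (nat \<times> nat) set" where
  "graph_rel E = {(i, j). {i, j} \<in> E}"

text \<open>D_{k,n}: every vertex in {k..<n} is joined by a path to some vertex in {0..<k}.\<close>
definition Dgraphs :: "nat \<Rightarrow> nat \<Rightarrow> nat set set set" where
  "Dgraphs k n = {E. E \<subseteq> {{i, j} | i j. i < n \<and> j < n \<and> i \<noteq> j} \<and>
       (\<forall>u. k \<le> u \<and> u < n \<longrightarrow> (\<exists>w<k. (u, w) \<in> (graph_rel E)\<^sup>*))}"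

definition psi :: "('a \<Rightarrow> 'a \<Rightarrow> ennreal) \<Rightarrow> nat \<Rightarrow> nat \<Rightarrow> (nat \<Rightarrow> 'a) \<Rightarrow> real" where
  "psi v k n x = (\<Sum>E\<in>Dgraphs k n. \<Prod>(i, j)\<in>{(i, j). {i, j} \<in> E \<and> i < j}. mayer v (x i) (x j))"

text \<open>Boltzmann weight exp(-sum_{i<j} v(x_i,x_j)) = prod_{i<j} (1 + f(x_i,x_j)).\<close>
definition weight :: "('a \<Rightarrow> 'a \<Rightarrow> ennreal) \<Rightarrow> nat \<Rightarrow> (nat \<Rightarrow> 'a) \<Rightarrow> real" where
  "weight v m x = (\<Prod>(i, j)\<in>{(i, j). i < j \<and> j < m}. 1 + mayer v (x i) (x j))"

text \<open>Integral of g against the n-th factorial measure of the configuration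
  eta = delta_{x_0} + ... + delta_{x_{m-1}}: sum over pairwise distinct indices.\<close>
definition factsum :: "nat \<Rightarrow> nat \<Rightarrow> ((nat \<Rightarrow> 'a) \<Rightarrow> ennreal) \<Rightarrow> (nat \<Rightarrow> 'a) \<Rightarrow> ennreal" where
  "factsum n m g x = (\<Sum>\<sigma>\<in>{\<sigma>\<in>{..<n} \<rightarrow>\<^sub>E {..<m}. inj_on \<sigma> {..<n}}.
       g (restrict (\<lambda>i. x (\<sigma> i)) {..<n}))"

text \<open>Expectation under the finite-volume Gibbs measure P_Lambda (empty boundary conditions)
  of a nonnegative functional F of the configuration, where F m x is its value on the
  configuration of the m points x_0..x_{m-1}.  The Poisson point process with finite
  intensity 1_Lambda lambda_z has Janossy densities exp(-lambda_z(Lambda))/m! w.r.t.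
  (1_Lambda lambda_z)^m; the factor exp(-lambda_z(Lambda)) cancels upon normalisation.\<close>
definition gibbs_expect :: "'a measure \<Rightarrow> ('a \<Rightarrow> real) \<Rightarrow> ('a \<Rightarrow> 'a \<Rightarrow> ennreal) \<Rightarrow> 'a set
    \<Rightarrow> (nat \<Rightarrow> (nat \<Rightarrow> 'a) \<Rightarrow> ennreal) \<Rightarrow> ennreal" where
  "gibbs_expect lam z v L F =
     (\<Sum>m. ennreal (1 / fact m) *
        (\<integral>\<^sup>+ x. F m x * ennreal (weight v m x) \<partial>PiM {..<m} (\<lambda>_. lamzL lam z L)))
     / (\<Sum>m. ennreal (1 / fact m) *
        (\<integral>\<^sup>+ x. ennreal (weight v m x) \<partial>PiM {..<m} (\<lambda>_. lamzL lam z L)))"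

text \<open>rho is (a version of) the n-th correlation function of P_Lambda: the density w.r.t.
  lambda^n of the n-th factorial moment measure.\<close>
definition is_corr_fun :: "'a measure \<Rightarrow> ('a \<Rightarrow> real) \<Rightarrow> ('a \<Rightarrow> 'a \<Rightarrow> ennreal) \<Rightarrow> 'a set
    \<Rightarrow> nat \<Rightarrow> ((nat \<Rightarrow> 'a) \<Rightarrow> ennreal) \<Rightarrow> bool" where
  "is_corr_fun lam z v L n \<rho> \<longleftrightarrow>
     \<rho> \<in> borel_measurable (PiM {..<n} (\<lambda>_. lam)) \<and>
     (\<forall>g \<in> borel_measurable (PiM {..<n} (\<lambda>_. lam)).
        gibbs_expect lam z v L (\<lambda>m x. factsum n m g x)
        = (\<integral>\<^sup>+ x. g x * \<rho> x \<partial>PiM {..<n} (\<lambda>_. lam)))"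

end

theory Submission
  imports Defs
begin

text \<open>
  Deleting a root \<open>x\<close> from a graph, with \<open>us\<close> the non-root neighbours of \<open>x\<close>, turns the functions
  \<open>\<psi>\<close> into solutions of the Kirkwood-Salsburg recursion
  \<open>\<psi>(x # xs; ys) = (\<Prod>x'\<in>xs. 1 + f x x') \<Sum>\<^sub>u\<^sub>s (\<Prod>u\<in>us. f x u) \<psi>(us @ xs; ys - us)\<close>.
  Since \<open>-1 \<le> f \<le> 0\<close>, it shows that the sign of \<open>\<psi>\<close> is \<open>(-1)\<close> to the number of non-roots, so the
  absolute values satisfy the same recursion with \<open>\<bar>f\<bar>\<close>. Integrating over the non-roots and inducting on
  a bound for the total number of points, the hypothesis on \<open>a\<close> closes the induction; the points
  violating it form a null set, and the bound holds at all configurations avoiding that set.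

  The Boltzmann weights obey the recursion as well, whence \<open>w(xs @ ys)\<close> is the sum of
  \<open>\<psi>(xs; us) w(ys - us)\<close> over the subconfigurations \<open>us\<close> of \<open>ys\<close>. Integrated over \<open>ys\<close>, this factorises
  with the partition function as second factor. By the Mecke formula the correlation function is the
  integral of \<open>w(xs @ ys)\<close> over \<open>ys\<close>, divided by the partition function.
\<close>

section \<open>Sums over subconfigurations\<close>

text \<open>Configurations are lists split by position, so coinciding points count separately and
  sums over subconfigurations are structural recursions. The hypothesis speaks about one point
  \<open>x0\<close> at a time, which is why the recursion deletes a single root: its promoted
  neighbours carry exactly the factors |f(x,u)| and the mutual weight found in the hypothesis. Their
  interaction with the old roots is discarded by 1 + f \<le> 1, whereas that of the deleted root
  with the other roots is kept and builds up the product over pairs in the bound. The hypothesis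
  lacks the term k = 0; its value 1 turns e^a - 1 into e^a, the contribution of the deleted root.

  The obstacle is that the series of the \<psi> alternates in sign and cannot be rearranged before
  its convergence is known. Integrals are therefore taken in \<open>ennreal\<close>, where sums and
  integrals commute freely, and the factorisation with the partition function is stated with
  positive and negative parts on opposite sides. Real series and Bochner integrals enter only once
  both parts are finite.\<close>

primrec split_sum :: "'a list \<Rightarrow> ('a list \<Rightarrow> 'a list \<Rightarrow> 'b::comm_monoid_add) \<Rightarrow> 'b" where
  "split_sum [] A = A [] []"
| "split_sum (y # ys) A = split_sum ys (\<lambda>us vs. A (y # us) vs) + split_sum ys (\<lambda>us vs. A us (y # vs))"

lemma split_sum_cong_mset:
  assumes "\<And>us vs. mset us + mset vs = mset ys \<Longrightarrow> A us vs = B us vs"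
  shows "split_sum ys A = split_sum ys B"
  using assms
proof (induction ys arbitrary: A B)
  case (Cons y ys)
  show ?case unfolding split_sum.simps
    by (intro arg_cong2[where f = "(+)"] Cons.IH Cons.prems) auto
qed auto

text \<open>Recording that both parts together have the length of the list is what makes
  \<open>rooted\<close> terminate: promoted points leave the non-roots, so the total drops by the
  deleted root alone.\<close>

lemma split_sum_cong [fundef_cong]:
  assumes "ys = ys'" "\<And>us vs. length us + length vs = length ys' \<Longrightarrow> A us vs = B us vs"
  shows "split_sum ys A = split_sum ys' B"
  unfolding assms(1) by (rule split_sum_cong_mset, rule assms(2)) (metis size_mset size_union)

lemma split_sum_map:
  "split_sum (map h ys) A = split_sum ys (\<lambda>us vs. A (map h us) (map h vs))"
  by (induction ys arbitrary: A) auto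

lemma split_sum_mult_left:
  fixes c :: "'b::semiring_0"
  shows "split_sum ys (\<lambda>us vs. c * A us vs) = c * split_sum ys A"
  by (induction ys arbitrary: A) (auto simp: distrib_left)

lemma split_sum_mult_right:
  fixes c :: "'b::semiring_0"
  shows "split_sum ys (\<lambda>us vs. A us vs * c) = split_sum ys A * c"
  by (induction ys arbitrary: A) (auto simp: distrib_right)

lemma split_sum_add:
  "split_sum ys (\<lambda>us vs. A us vs + B us vs) = split_sum ys A + split_sum ys B"
  by (induction ys arbitrary: A B) (auto simp: add_ac)

text \<open>Both sides run over all distributions of \<open>ys\<close> into three sublists.\<close>

lemma split_sum_assoc:
  "split_sum ys (\<lambda>as bs. split_sum as (\<lambda>us vs. H us vs bs))
   = split_sum ys (\<lambda>us ws. split_sum ws (\<lambda>vs bs. H us vs bs))"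
proof (induction ys arbitrary: H)
  case (Cons y ys)
  show ?case
    using Cons[of "\<lambda>us vs bs. H (y # us) vs bs"] Cons[of "\<lambda>us vs bs. H us (y # vs) bs"]
      Cons[of "\<lambda>us vs bs. H us vs (y # bs)"]
    by (simp add: split_sum_add add_ac)
qed auto

lemma split_sum_nonneg:
  fixes A :: "'a list \<Rightarrow> 'a list \<Rightarrow> real"
  assumes "\<And>us vs. length us + length vs = length ys \<Longrightarrow> 0 \<le> A us vs"
  shows "0 \<le> split_sum ys A"
  using assms by (induction ys arbitrary: A) auto

lemma split_sum_ennreal:
  assumes "\<And>us vs. length us + length vs = length ys \<Longrightarrow> 0 \<le> A us vs"
  shows "split_sum ys (\<lambda>us vs. ennreal (A us vs)) = ennreal (split_sum ys A)"
  using assms by (induction ys arbitrary: A) (auto simp: split_sum_nonneg)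

lemma split_sum_prod_list:
  fixes g :: "'a \<Rightarrow> 'b::comm_semiring_1"
  shows "(\<Prod>y\<leftarrow>ys. 1 + g y) = split_sum ys (\<lambda>us vs. \<Prod>u\<leftarrow>us. g u)"
  by (induction ys) (auto simp: split_sum_mult_left algebra_simps)

lemma split_sum_Pow:
  assumes "distinct js"
  shows "split_sum js (\<lambda>us vs. H (set us) (set vs)) = (\<Sum>J\<in>Pow (set js). H J (set js - J))"
  using assms
proof (induction js arbitrary: H)
  case (Cons j js)
  have "(\<Sum>J\<in>Pow (set (j # js)). H J (set (j # js) - J))
      = (\<Sum>J\<in>Pow (set js). H J (set (j # js) - J)) + (\<Sum>J\<in>insert j ` Pow (set js). H J (set (j # js) - J))"
    using Cons.prems by (auto simp: Pow_insert intro!: sum.union_disjoint)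
  also have "(\<Sum>J\<in>Pow (set js). H J (set (j # js) - J)) = (\<Sum>J\<in>Pow (set js). H J (insert j (set js - J)))"
    using Cons.prems by (intro sum.cong refl arg_cong2[where f = H]) auto
  also have "(\<Sum>J\<in>insert j ` Pow (set js). H J (set (j # js) - J))
      = (\<Sum>J\<in>Pow (set js). H (insert j J) (set (j # js) - insert j J))"
    using Cons.prems by (subst sum.reindex) (auto simp: inj_on_def o_def)
  also have "\<dots> = (\<Sum>J\<in>Pow (set js). H (insert j J) (set js - J))"
    using Cons.prems by (intro sum.cong refl arg_cong2[where f = H]) auto
  finally show ?case
    using Cons.prems Cons.IH[of "\<lambda>J K. H (insert j J) K"] Cons.IH[of "\<lambda>J K. H J (insert j K)"]
    by (simp add: add.commute)
qed auto

section \<open>Sums over distinct points of a configuration\<close>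

primrec pick_sum :: "'a list \<Rightarrow> ('a \<Rightarrow> 'a list \<Rightarrow> 'b::comm_monoid_add) \<Rightarrow> 'b" where
  "pick_sum [] B = 0"
| "pick_sum (y # ys) B = B y ys + pick_sum ys (\<lambda>u us. B u (y # us))"

lemma pick_sum_cong:
  assumes "\<And>u us. mset (u # us) = mset ys \<Longrightarrow> A u us = B u us"
  shows "pick_sum ys A = pick_sum ys B"
  using assms
proof (induction ys arbitrary: A B)
  case (Cons y ys)
  show ?case unfolding pick_sum.simps
    by (intro arg_cong2[where f = "(+)"] Cons.IH Cons.prems) auto
qed auto

lemma pick_sum_map:
  "pick_sum (map h ys) A = pick_sum ys (\<lambda>u us. A (h u) (map h us))"
  by (induction ys arbitrary: A) auto

lemma pick_sum_set:
  assumes "distinct js"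
  shows "pick_sum js (\<lambda>u us. H u (set us)) = (\<Sum>j\<in>set js. H j (set js - {j}))"
  using assms
proof (induction js arbitrary: H)
  case (Cons j js)
  have "(\<Sum>i\<in>set (j # js). H i (set (j # js) - {i}))
      = H j (set js) + (\<Sum>i\<in>set js. H i (set (j # js) - {i}))"
    using Cons.prems by (simp add: insert_Diff_if)
  also have "(\<Sum>i\<in>set js. H i (set (j # js) - {i})) = (\<Sum>i\<in>set js. H i (insert j (set js - {i})))"
    using Cons.prems by (intro sum.cong refl arg_cong2[where f = H]) auto
  finally show ?case
    using Cons.prems Cons.IH[of "\<lambda>i J. H i (insert j J)"] by simp
qed auto

text \<open>The integral against the factorial measure, as a sum over ordered tuples of distinct
  positions. Unlike \<open>factsum\<close> it also passes the remaining points \<open>vs\<close> to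
  the summand, as the Mecke formula requires.\<close>

primrec fact_sum :: "nat \<Rightarrow> 'a list \<Rightarrow> ('a list \<Rightarrow> 'a list \<Rightarrow> 'b::comm_monoid_add) \<Rightarrow> 'b" where
  "fact_sum 0 ys A = A [] ys"
| "fact_sum (Suc n) ys A = pick_sum ys (\<lambda>u us. fact_sum n us (\<lambda>ws vs. A (u # ws) vs))"

lemma fact_sum_cong:
  assumes "\<And>us vs. length us = n \<Longrightarrow> mset us + mset vs = mset ys \<Longrightarrow> A us vs = B us vs"
  shows "fact_sum n ys A = fact_sum n ys B"
  using assms
proof (induction n arbitrary: ys A B)
  case (Suc n)
  show ?case unfolding fact_sum.simps
    by (intro pick_sum_cong Suc.IH Suc.prems) (auto simp flip: union_assoc)
qed auto

lemma fact_sum_map: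
  "fact_sum n (map h ys) A = fact_sum n ys (\<lambda>us vs. A (map h us) (map h vs))"
  by (induction n arbitrary: ys A) (auto simp: pick_sum_map)

lemma pick_sum_mult_right:
  fixes c :: "'b::semiring_0"
  shows "pick_sum ys (\<lambda>us vs. A us vs * c) = pick_sum ys A * c"
  by (induction ys arbitrary: A) (auto simp: distrib_right)

lemma fact_sum_mult_right:
  fixes c :: "'b::semiring_0"
  shows "fact_sum n ys (\<lambda>us vs. A us vs * c) = fact_sum n ys A * c"
  by (induction n arbitrary: ys A) (auto simp: pick_sum_mult_right)

lemma fact_sum_distinct_lists:
  assumes "distinct js"
  shows "fact_sum n js (\<lambda>us vs. H us) = (\<Sum>us\<in>{us. length us = n \<and> distinct us \<and> set us \<subseteq> set js}. H us)"
  using assms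
proof (induction n arbitrary: js H)
  case (Suc n)
  let ?D = "\<lambda>n I. {us. length us = n \<and> distinct us \<and> set us \<subseteq> I}"
  have fin: "finite (?D m (set ks))" for m and ks :: "'a list"
    by (rule finite_subset[OF _ finite_lists_length_eq[of "set ks" m]]) auto
  have "fact_sum (Suc n) js (\<lambda>us vs. H us) = pick_sum js (\<lambda>u us. \<Sum>ws\<in>?D n (set us). H (u # ws))"
    unfolding fact_sum.simps
  proof (rule pick_sum_cong)
    fix u us assume "mset (u # us) = mset js"
    with Suc.prems have "distinct (u # us)" by (metis mset_eq_imp_distinct_iff)
    then show "fact_sum n us (\<lambda>ws vs. H (u # ws)) = (\<Sum>ws\<in>?D n (set us). H (u # ws))"
      by (intro Suc.IH) simp
  qed
  also have "\<dots> = (\<Sum>j\<in>set js. \<Sum>ws\<in>?D n (set js - {j}). H (j # ws))"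
    by (rule pick_sum_set[OF Suc.prems])
  also have "\<dots> = (\<Sum>(j, ws)\<in>Sigma (set js) (\<lambda>j. ?D n (set js - {j})). H (j # ws))"
    by (rule sum.Sigma) (auto intro: finite_subset[OF _ fin[of n js]])
  also have "\<dots> = (\<Sum>us\<in>?D (Suc n) (set js). H us)"
    by (rule sum.reindex_bij_witness[of _ "\<lambda>us. (hd us, tl us)" "\<lambda>(j, ws). j # ws"])
       (auto simp: length_Suc_conv)
  finally show ?case .
next
  case 0
  have "{us. length us = 0 \<and> distinct us \<and> set us \<subseteq> set js} = {[]}" by auto
  then show ?case by simp
qed

text \<open>An injection of \<open>{..<n}\<close> into \<open>{..<m}\<close> is a distinct list of
  indices. Picking indices instead of points keeps the count right when points coincide.\<close>

lemma factsum_eq_fact_sum: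
  "factsum n m g x = fact_sum n (map x [0..<m]) (\<lambda>us vs. g (\<lambda>i\<in>{..<n}. us ! i))"
proof -
  have "factsum n m g x = (\<Sum>us\<in>{us. length us = n \<and> distinct us \<and> set us \<subseteq> set [0..<m]}.
      g (\<lambda>i\<in>{..<n}. map x us ! i))"
    unfolding factsum_def
  proof (rule sum.reindex_bij_witness[of _ "\<lambda>us. \<lambda>i\<in>{..<n}. us ! i" "\<lambda>\<sigma>. map \<sigma> [0..<n]"])
    fix \<sigma> assume s: "\<sigma> \<in> {\<sigma> \<in> {..<n} \<rightarrow>\<^sub>E {..<m}. inj_on \<sigma> {..<n}}"
    then show "(\<lambda>i\<in>{..<n}. map \<sigma> [0..<n] ! i) = \<sigma>"
      by (auto simp: fun_eq_iff PiE_def extensional_def restrict_def)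
    show "map \<sigma> [0..<n] \<in> {us. length us = n \<and> distinct us \<and> set us \<subseteq> set [0..<m]}"
      using s by (auto simp: distinct_map lessThan_atLeast0)
    show "g (\<lambda>i\<in>{..<n}. map x (map \<sigma> [0..<n]) ! i) = g (\<lambda>i\<in>{..<n}. x (\<sigma> i))"
      by (intro arg_cong[where f = g]) auto
  next
    fix us assume s: "us \<in> {us. length us = n \<and> distinct us \<and> set us \<subseteq> set [0..<m]}"
    then show "map (\<lambda>i\<in>{..<n}. us ! i) [0..<n] = us"
      by (auto intro!: nth_equalityI)
    show "(\<lambda>i\<in>{..<n}. us ! i) \<in> {\<sigma> \<in> {..<n} \<rightarrow>\<^sub>E {..<m}. inj_on \<sigma> {..<n}}"
      using s by (auto simp: inj_on_def nth_eq_iff_index_eq dest!: nth_mem)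
  qed
  also have "\<dots> = fact_sum n [0..<m] (\<lambda>us vs. g (\<lambda>i\<in>{..<n}. map x us ! i))"
    by (rule fact_sum_distinct_lists[symmetric]) simp
  finally show ?thesis by (simp add: fact_sum_map)
qed

section \<open>Boltzmann weights and the Kirkwood-Salsburg recursion\<close>

primrec boltzmann :: "('a \<Rightarrow> 'a \<Rightarrow> real) \<Rightarrow> 'a list \<Rightarrow> real" where
  "boltzmann f [] = 1"
| "boltzmann f (x # xs) = (\<Prod>x'\<leftarrow>xs. 1 + f x x') * boltzmann f xs"

lemma boltzmann_move:
  assumes "\<And>x y. f x y = f y x"
  shows "boltzmann f (xs @ y # ys) = boltzmann f (y # xs @ ys)"
  by (induction xs) (auto simp: assms[of y])

lemma boltzmann_perm:
  assumes "\<And>x y. f x y = f y x" "mset xs = mset ys"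
  shows "boltzmann f xs = boltzmann f ys"
  using assms(2)
proof (induction xs arbitrary: ys)
  case (Cons x xs)
  then have "x \<in> set ys" by (metis list.set_intros(1) mset_eq_setD)
  then obtain as bs where ys: "ys = as @ x # bs" by (metis split_list)
  with Cons.prems have "mset xs = mset (as @ bs)" by simp
  from Cons.IH[OF this] this have "boltzmann f (x # xs) = boltzmann f (x # as @ bs)"
    by (simp flip: prod_mset_prod_list)
  then show ?case by (simp only: ys boltzmann_move[of f, OF assms(1)])
qed simp

text \<open>The functions \<open>\<psi>\<close>, defined through the Kirkwood-Salsburg recursion instead of through graphs.\<close>
function rooted :: "('a \<Rightarrow> 'a \<Rightarrow> real) \<Rightarrow> 'a list \<Rightarrow> 'a list \<Rightarrow> real" where
  "rooted f [] ys = (if ys = [] then 1 else 0)"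
| "rooted f (x # xs) ys = (\<Prod>x'\<leftarrow>xs. 1 + f x x') *
     split_sum ys (\<lambda>us vs. (\<Prod>u\<leftarrow>us. f x u) * rooted f (us @ xs) vs)"
  by pat_completeness auto
termination by (relation "Wellfounded.measure (\<lambda>(f, xs, ys). length xs + length ys)") auto

lemma rooted_Nil2: "rooted f xs [] = boltzmann f xs"
  by (induction xs) auto

lemma boltzmann_split:
  assumes sym: "\<And>x y. f x y = f y x"
  shows "boltzmann f (xs @ ys) = split_sum ys (\<lambda>us vs. rooted f xs us * boltzmann f vs)"
proof (induction "length xs + length ys" arbitrary: xs ys)
  case 0
  then show ?case by simp
next
  case (Suc n)
  show ?case
  proof (cases xs)
    case Nil
    \<comment> \<open>Without roots only \<open>us = []\<close> contributes. The instance
      \<open>c = 0\<close> of \<open>split_sum_mult_left\<close> says that a split sum of zeros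
      vanishes.\<close>
    have "split_sum zs (\<lambda>us vs. rooted f [] us * B vs) = B zs" for zs B
      by (induction zs arbitrary: B) (auto simp: split_sum_mult_left[of _ 0, simplified])
    with Nil show ?thesis by simp
  next
    case (Cons x xs')
    define c where "c = (\<Prod>x'\<leftarrow>xs'. 1 + f x x')"
    \<comment> \<open>Only the factors between \<open>x\<close> and \<open>ys\<close> are expanded,
      into a sum over the points \<open>us\<close> tied to \<open>x\<close>; the factors between
      \<open>x\<close> and the other roots stay together in \<open>c\<close>.\<close>
    have "boltzmann f (xs @ ys) = c * split_sum ys (\<lambda>us vs. (\<Prod>u\<leftarrow>us. f x u) * boltzmann f (xs' @ ys))"
      by (simp add: Cons c_def split_sum_prod_list split_sum_mult_right)
    also have "split_sum ys (\<lambda>us vs. (\<Prod>u\<leftarrow>us. f x u) * boltzmann f (xs' @ ys))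
      = split_sum ys (\<lambda>us vs. (\<Prod>u\<leftarrow>us. f x u) *
          split_sum vs (\<lambda>vs bs. rooted f (us @ xs') vs * boltzmann f bs))"
    proof (rule split_sum_cong_mset)
      fix us vs assume m: "mset us + mset vs = mset ys"
      then have "length us + length vs = length ys" by (metis size_mset size_union)
      with Suc(2) Cons have "n = length (us @ xs') + length vs" by simp
      from Suc(1)[OF this]
      have "boltzmann f ((us @ xs') @ vs) = split_sum vs (\<lambda>vs bs. rooted f (us @ xs') vs * boltzmann f bs)" .
      \<comment> \<open>The weight is symmetric, so \<open>us\<close> may be moved to the front to
        join the roots.\<close>
      moreover have "boltzmann f (xs' @ ys) = boltzmann f ((us @ xs') @ vs)"
        by (rule boltzmann_perm) (auto simp: sym m[symmetric])
      ultimately show "(\<Prod>u\<leftarrow>us. f x u) * boltzmann f (xs' @ ys) = (\<Prod>u\<leftarrow>us. f x u) *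
          split_sum vs (\<lambda>vs bs. rooted f (us @ xs') vs * boltzmann f bs)" by simp
    qed
    also have "\<dots> = split_sum ys (\<lambda>as bs. split_sum as (\<lambda>us vs. (\<Prod>u\<leftarrow>us. f x u) * rooted f (us @ xs') vs) * boltzmann f bs)"
      unfolding split_sum_mult_left[symmetric] split_sum_mult_right[symmetric] split_sum_assoc
      by (simp only: mult.assoc)
    finally show ?thesis
      by (simp add: Cons c_def split_sum_mult_left mult.assoc)
  qed
qed

lemma prod_list_mem01:
  assumes "\<And>u. u \<in> set us \<Longrightarrow> 0 \<le> g u \<and> g u \<le> (1::real)"
  shows "0 \<le> (\<Prod>u\<leftarrow>us. g u) \<and> (\<Prod>u\<leftarrow>us. g u) \<le> 1"
  using assms by (induction us) (auto intro: mult_le_one)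

lemma boltzmann_mem01:
  assumes f: "\<And>x y. 0 \<le> 1 + f x y" "\<And>x y. f x y \<le> 0"
  shows "0 \<le> boltzmann f xs \<and> boltzmann f xs \<le> 1"
proof (induction xs)
  case (Cons x xs)
  have "0 \<le> (\<Prod>x'\<leftarrow>xs. 1 + f x x') \<and> (\<Prod>x'\<leftarrow>xs. 1 + f x x') \<le> 1"
    by (rule prod_list_mem01) (simp add: f)
  with Cons show ?case by (auto intro: mult_le_one)
qed simp

lemma sign_prod_list:
  assumes "\<And>u. u \<in> set us \<Longrightarrow> g u \<le> (0::real)"
  shows "(-1) ^ length us * (\<Prod>u\<leftarrow>us. g u) = (\<Prod>u\<leftarrow>us. \<bar>g u\<bar>)"
  using assms by (induction us) (auto simp: abs_of_nonpos algebra_simps)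

text \<open>Non-roots disappear only by promotion, and each promotion costs one factor f \<le> 0;
  the prefactor 1 + f \<ge> 0 carries no sign.\<close>

lemma rooted_sign:
  assumes f: "\<And>x y. 0 \<le> 1 + f x y" "\<And>x y. f x y \<le> 0"
  shows "0 \<le> (-1) ^ length ys * rooted f xs ys"
proof (induction "length xs + length ys" arbitrary: xs ys)
  case 0
  then show ?case by simp
next
  case (Suc n)
  show ?case
  proof (cases xs)
    case (Cons x xs')
    have "0 \<le> (-1) ^ length ys * ((\<Prod>u\<leftarrow>us. f x u) * rooted f (us @ xs') vs)"
      if l: "length us + length vs = length ys" for us vs
    proof -
      have "0 \<le> (\<Prod>u\<leftarrow>us. \<bar>f x u\<bar>)"
        by (rule prod_list_nonneg) auto
      moreover have "0 \<le> (-1) ^ length vs * rooted f (us @ xs') vs"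
        using l Suc(2) Cons by (intro Suc(1)) simp
      ultimately have "0 \<le> (\<Prod>u\<leftarrow>us. \<bar>f x u\<bar>) * ((-1) ^ length vs * rooted f (us @ xs') vs)"
        by (rule mult_nonneg_nonneg)
      also have "\<dots> = (-1) ^ length ys * ((\<Prod>u\<leftarrow>us. f x u) * rooted f (us @ xs') vs)"
        using sign_prod_list[of us "f x"] f(2) by (simp add: l[symmetric] power_add mult_ac)
      finally show ?thesis .
    qed
    then have "0 \<le> split_sum ys (\<lambda>us vs. (-1) ^ length ys * ((\<Prod>u\<leftarrow>us. f x u) * rooted f (us @ xs') vs))"
      by (rule split_sum_nonneg)
    moreover have "0 \<le> (\<Prod>x'\<leftarrow>xs'. 1 + f x x')"
      by (rule prod_list_nonneg) (auto simp: f(1))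
    ultimately have "0 \<le> (\<Prod>x'\<leftarrow>xs'. 1 + f x x') * ((-1) ^ length ys *
        split_sum ys (\<lambda>us vs. (\<Prod>u\<leftarrow>us. f x u) * rooted f (us @ xs') vs))"
      unfolding split_sum_mult_left by (rule mult_nonneg_nonneg[rotated])
    then show ?thesis by (simp add: Cons mult_ac)
  qed auto
qed

text \<open>All terms of the recursion have the sign of (-1) to the power \<open>length ys\<close>,
  so nothing cancels and the absolute value passes through the sum.\<close>

lemma abs_rooted_Cons:
  fixes f :: "'a \<Rightarrow> 'a \<Rightarrow> real"
  assumes f: "\<And>x y. 0 \<le> 1 + f x y" "\<And>x y. f x y \<le> 0"
  shows "\<bar>rooted f (x # xs) ys\<bar> = (\<Prod>x'\<leftarrow>xs. 1 + f x x') *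
     split_sum ys (\<lambda>us vs. (\<Prod>u\<leftarrow>us. \<bar>f x u\<bar>) * \<bar>rooted f (us @ xs) vs\<bar>)"
proof -
  have abs: "\<bar>rooted f as bs\<bar> = (-1) ^ length bs * rooted f as bs" for as bs
    using rooted_sign[of f bs as, OF f] by (cases "even (length bs)") auto
  have "\<bar>rooted f (x # xs) ys\<bar> = (\<Prod>x'\<leftarrow>xs. 1 + f x x') *
     split_sum ys (\<lambda>us vs. (-1) ^ length ys * ((\<Prod>u\<leftarrow>us. f x u) * rooted f (us @ xs) vs))"
    unfolding abs split_sum_mult_left by (simp add: mult_ac)
  also have "split_sum ys (\<lambda>us vs. (-1) ^ length ys * ((\<Prod>u\<leftarrow>us. f x u) * rooted f (us @ xs) vs))
     = split_sum ys (\<lambda>us vs. (\<Prod>u\<leftarrow>us. \<bar>f x u\<bar>) * \<bar>rooted f (us @ xs) vs\<bar>)"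
  proof (intro split_sum_cong refl)
    fix us vs :: "'a list" assume l: "length us + length vs = length ys"
    show "(-1) ^ length ys * ((\<Prod>u\<leftarrow>us. f x u) * rooted f (us @ xs) vs)
        = (\<Prod>u\<leftarrow>us. \<bar>f x u\<bar>) * \<bar>rooted f (us @ xs) vs\<bar>"
      using sign_prod_list[of us "f x"] f(2) by (simp add: abs l[symmetric] power_add mult_ac)
  qed
  finally show ?thesis .
qed


section \<open>Rooted graphs\<close>

text \<open>Arbitrary sets of roots and non-roots are allowed because deleting a root and promoting
  its neighbours destroys the initial segments used in \<open>Dgraphs\<close>.\<close>

definition rooted_graphs :: "nat set \<Rightarrow> nat set \<Rightarrow> nat set set set" where
  "rooted_graphs R S = {E. E \<subseteq> {{i, j} | i j. i \<in> R \<union> S \<and> j \<in> R \<union> S \<and> i \<noteq> j} \<and>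
     (\<forall>u\<in>S. \<exists>w\<in>R. (u, w) \<in> (graph_rel E)\<^sup>*)}"

definition edge_prod :: "(nat \<Rightarrow> nat \<Rightarrow> real) \<Rightarrow> nat set set \<Rightarrow> real" where
  "edge_prod F E = (\<Prod>(i, j)\<in>{(i, j). {i, j} \<in> E \<and> i < j}. F i j)"

definition graph_sum :: "(nat \<Rightarrow> nat \<Rightarrow> real) \<Rightarrow> nat set \<Rightarrow> nat set \<Rightarrow> real" where
  "graph_sum F R S = (\<Sum>E\<in>rooted_graphs R S. edge_prod F E)"

lemma psi_eq_graph_sum:
  assumes "k \<le> n"
  shows "psi v k n x = graph_sum (\<lambda>i j. mayer v (x i) (x j)) {..<k} {k..<n}"
proof -
  have "{..<k} \<union> {k..<n} = {..<n}" using assms by auto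
  then have "Dgraphs k n = rooted_graphs {..<k} {k..<n}"
    unfolding Dgraphs_def rooted_graphs_def by auto
  then show ?thesis by (simp add: psi_def graph_sum_def edge_prod_def)
qed

lemma finite_edge_pairs:
  assumes "finite V" "E \<subseteq> Pow V"
  shows "finite {(i, j). {i, j} \<in> E \<and> i < (j::nat)}"
  by (rule finite_subset[of _ "V \<times> V"]) (use assms in auto)

lemma edge_prod_union:
  assumes "finite V" "E \<subseteq> Pow V" "E' \<subseteq> Pow V" "E \<inter> E' = {}"
  shows "edge_prod F (E \<union> E') = edge_prod F E * edge_prod F E'"
proof -
  have "{(i, j). {i, j} \<in> E \<union> E' \<and> i < j} = {(i, j). {i, j} \<in> E \<and> i < j} \<union> {(i, j). {i, j} \<in> E' \<and> i < j}"
    by auto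
  then show ?thesis unfolding edge_prod_def
    using assms by (simp only:) (rule prod.union_disjoint, auto intro: finite_edge_pairs)
qed

text \<open>Edges enter \<open>edge_prod\<close> with the smaller endpoint first; symmetry of
  \<open>F\<close> allows each of them to be read from the centre \<open>r\<close>.\<close>

lemma edge_prod_star:
  assumes "r \<notin> A" and sym: "\<And>i j. F i j = F j i"
  shows "edge_prod F ((\<lambda>j. {r, j}) ` A) = (\<Prod>j\<in>A. F r j)"
  unfolding edge_prod_def
proof (rule prod.reindex_bij_witness[of _ "\<lambda>j. (min r j, max r j)" "\<lambda>(i, j). if i = r then j else i"])
  fix p assume "p \<in> {(i, j). {i, j} \<in> (\<lambda>j. {r, j}) ` A \<and> i < j}"
  then show "(min r (case p of (i, j) \<Rightarrow> if i = r then j else i), max r (case p of (i, j) \<Rightarrow> if i = r then j else i)) = p"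
    "(case p of (i, j) \<Rightarrow> if i = r then j else i) \<in> A"
    "F r (case p of (i, j) \<Rightarrow> if i = r then j else i) = (case p of (i, j) \<Rightarrow> F i j)"
    using sym by (auto simp: doubleton_eq_iff)
next
  fix j assume j: "j \<in> A"
  with assms(1) have "j \<noteq> r" by auto
  then show "(case (min r j, max r j) of (i, k) \<Rightarrow> if i = r then k else i) = j"
    by (auto simp: min_def max_def)
  have "{min r j, max r j} = {r, j}" by (auto simp: min_def max_def)
  with j \<open>j \<noteq> r\<close> show "(min r j, max r j) \<in> {(i, j). {i, j} \<in> (\<lambda>j. {r, j}) ` A \<and> i < j}"
    by (auto simp: min_def max_def)
qed

text \<open>A path that reaches \<open>r\<close> can be cut just before its first visit there: the
  vertex at the cut is a neighbour of \<open>r\<close>, hence another old root or a promoted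
  one.\<close>

lemma rooted_graphs_remove_root:
  assumes r: "r \<in> R" "R \<inter> S = {}" and E: "E \<in> rooted_graphs R S"
  shows "{e \<in> E. r \<notin> e} \<in> rooted_graphs (R - {r} \<union> {j \<in> S. {r, j} \<in> E}) (S - {j \<in> S. {r, j} \<in> E})"
proof -
  let ?J = "{j \<in> S. {r, j} \<in> E}" and ?E = "{e \<in> E. r \<notin> e}"
  have sub: "E \<subseteq> {{i, j} | i j. i \<in> R \<union> S \<and> j \<in> R \<union> S \<and> i \<noteq> j}"
    and conn: "\<And>u. u \<in> S \<Longrightarrow> \<exists>w\<in>R. (u, w) \<in> (graph_rel E)\<^sup>*"
    using E by (auto simp: rooted_graphs_def)
  have V: "R \<union> S - {r} = (R - {r} \<union> ?J) \<union> (S - ?J)" using r by auto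
  have "?E \<subseteq> {{i, j} | i j. i \<in> R \<union> S - {r} \<and> j \<in> R \<union> S - {r} \<and> i \<noteq> j}"
  proof
    fix e assume e: "e \<in> ?E"
    then obtain i j where "e = {i, j}" "i \<in> R \<union> S" "j \<in> R \<union> S" "i \<noteq> j" using sub by blast
    moreover from this e have "i \<noteq> r" "j \<noteq> r" by auto
    ultimately show "e \<in> {{i, j} | i j. i \<in> R \<union> S - {r} \<and> j \<in> R \<union> S - {r} \<and> i \<noteq> j}" by blast
  qed
  moreover have "\<exists>w\<in>R - {r} \<union> ?J. (u, w) \<in> (graph_rel ?E)\<^sup>*" if u: "u \<in> S - ?J" for u
  proof -
    obtain w where w: "w \<in> R" "(u, w) \<in> (graph_rel E)\<^sup>*" using conn u by auto
    \<comment> \<open>The guard is needed because the induction walks along the original path, which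
      may pass through \<open>r\<close> itself.\<close>
    have "u \<noteq> r \<longrightarrow> (\<exists>w\<in>R - {r} \<union> ?J. (u, w) \<in> (graph_rel ?E)\<^sup>*)"
      using w(2)
    proof (induction rule: converse_rtrancl_induct)
      case base
      then show ?case using w(1) by blast
    next
      case (step u u')
      have e: "{u, u'} \<in> E" using step(1) by (simp add: graph_rel_def)
      show ?case
      proof (cases "u' = r")
        case True
        with e sub r have "u \<noteq> r \<Longrightarrow> u \<in> R - {r} \<union> ?J" by (auto simp: insert_commute)
        then show ?thesis by blast
      next
        case False
        show ?thesis
        proof
          assume "u \<noteq> r"
          with False e have "(u, u') \<in> graph_rel ?E" by (simp add: graph_rel_def)
          with step(3) False show "\<exists>w\<in>R - {r} \<union> ?J. (u, w) \<in> (graph_rel ?E)\<^sup>*"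
            by (meson converse_rtrancl_into_rtrancl)
        qed
      qed
    qed
    with u r show ?thesis by auto
  qed
  ultimately show ?thesis unfolding rooted_graphs_def V by blast
qed

text \<open>A path ending in a promoted neighbour is prolonged by one edge to \<open>r\<close>. The
  set \<open>A\<close> is free, as connectivity asks nothing of edges between roots.\<close>

lemma rooted_graphs_add_root:
  assumes r: "r \<in> R" "R \<inter> S = {}" and A: "A \<subseteq> R - {r}" and J: "J \<subseteq> S"
    and E: "E \<in> rooted_graphs (R - {r} \<union> J) (S - J)"
  shows "(\<lambda>j. {r, j}) ` (A \<union> J) \<union> E \<in> rooted_graphs R S"
proof -
  let ?E = "(\<lambda>j. {r, j}) ` (A \<union> J) \<union> E"
  have sub: "E \<subseteq> {{i, j} | i j. i \<in> R \<union> S \<and> j \<in> R \<union> S \<and> i \<noteq> j}"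
    and conn: "\<And>u. u \<in> S - J \<Longrightarrow> \<exists>w\<in>R - {r} \<union> J. (u, w) \<in> (graph_rel E)\<^sup>*"
  proof -
    have "(R - {r} \<union> J) \<union> (S - J) \<subseteq> R \<union> S" using J by auto
    then show "E \<subseteq> {{i, j} | i j. i \<in> R \<union> S \<and> j \<in> R \<union> S \<and> i \<noteq> j}"
      using E unfolding rooted_graphs_def by blast
    show "\<And>u. u \<in> S - J \<Longrightarrow> \<exists>w\<in>R - {r} \<union> J. (u, w) \<in> (graph_rel E)\<^sup>*"
      using E unfolding rooted_graphs_def by blast
  qed
  have mono: "(graph_rel E)\<^sup>* \<subseteq> (graph_rel ?E)\<^sup>*"
    by (rule rtrancl_mono) (auto simp: graph_rel_def)
  have J1: "(j, r) \<in> graph_rel ?E" if "j \<in> J" for j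
    using that by (auto simp: graph_rel_def insert_commute)
  have "\<exists>w\<in>R. (u, w) \<in> (graph_rel ?E)\<^sup>*" if "u \<in> S" for u
  proof (cases "u \<in> J")
    case True
    then show ?thesis using J1 r by blast
  next
    case False
    then have "u \<in> S - J" using that by simp
    from conn[OF this] mono obtain w where w: "w \<in> R - {r} \<union> J" "(u, w) \<in> (graph_rel ?E)\<^sup>*"
      by blast
    show ?thesis
    proof (cases "w \<in> J")
      case True
      from w(2) J1[OF this] have "(u, r) \<in> (graph_rel ?E)\<^sup>*" by (rule rtrancl_into_rtrancl)
      then show ?thesis using r by blast
    qed (use w in blast)
  qed
  moreover have "{r, j} \<in> {{i, j} | i j. i \<in> R \<union> S \<and> j \<in> R \<union> S \<and> i \<noteq> j}" if "j \<in> A \<union> J" for j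
  proof -
    have "r \<in> R \<union> S" "j \<in> R \<union> S" "r \<noteq> j" using r A J that by auto
    then show ?thesis by blast
  qed
  ultimately show ?thesis unfolding rooted_graphs_def using sub by auto
qed

text \<open>A graph is determined by the root neighbours \<open>A\<close> of \<open>r\<close>, its
  non-root neighbours \<open>J\<close>, and what remains after deleting \<open>r\<close>. Since
  \<open>A\<close> is unconstrained, its sum splits off and multiplies out to the product of the
  \<open>1 + F r j\<close>.\<close>

lemma graph_sum_remove_root:
  assumes r: "r \<in> R" and fin: "finite R" "finite S" and disj: "R \<inter> S = {}"
    and sym: "\<And>i j. F i j = F j i"
  shows "graph_sum F R S = (\<Prod>j\<in>R - {r}. 1 + F r j) *
    (\<Sum>J\<in>Pow S. (\<Prod>j\<in>J. F r j) * graph_sum F (R - {r} \<union> J) (S - J))"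
proof -
  define T where "T = Sigma (Pow (R - {r}) \<times> Pow S) (\<lambda>(A, J). rooted_graphs (R - {r} \<union> J) (S - J))"
  have gfin: "finite (rooted_graphs R' S')" if "R' \<union> S' \<subseteq> R \<union> S" for R' S'
    by (rule finite_subset[of _ "Pow (Pow (R \<union> S))"]) (use that fin in \<open>auto simp: rooted_graphs_def\<close>)
  define enc where "enc = (\<lambda>((A, J), E). (\<lambda>j. {r, j}) ` (A \<union> J) \<union> E)"
  define dec where "dec = (\<lambda>E. (({j \<in> R - {r}. {r, j} \<in> E}, {j \<in> S. {r, j} \<in> E}), {e \<in> E. r \<notin> e}))"
  have "graph_sum F R S = (\<Sum>((A, J), E)\<in>T. (\<Prod>j\<in>A. F r j) * ((\<Prod>j\<in>J. F r j) * edge_prod F E))"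
    unfolding graph_sum_def
  proof (rule sum.reindex_bij_witness[of _ enc dec])
    fix E assume E: "E \<in> rooted_graphs R S"
    define A where "A = {j \<in> R - {r}. {r, j} \<in> E}"
    define J where "J = {j \<in> S. {r, j} \<in> E}"
    define E' where "E' = {e \<in> E. r \<notin> e}"
    have sub: "E \<subseteq> {{i, j} | i j. i \<in> R \<union> S \<and> j \<in> R \<union> S \<and> i \<noteq> j}"
      using E by (auto simp: rooted_graphs_def)
    have star: "(\<lambda>j. {r, j}) ` (A \<union> J) \<union> E' = E"
    proof
      show "E \<subseteq> (\<lambda>j. {r, j}) ` (A \<union> J) \<union> E'"
      proof
        fix e assume e: "e \<in> E"
        then obtain i j where ij: "e = {i, j}" "i \<in> R \<union> S" "j \<in> R \<union> S" "i \<noteq> j" using sub by blast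
        show "e \<in> (\<lambda>j. {r, j}) ` (A \<union> J) \<union> E'"
        proof (cases "r \<in> e")
          case True
          then obtain k where "e = {r, k}" "k \<in> R \<union> S" "k \<noteq> r"
            using ij by (metis doubleton_eq_iff insertE singletonD)
          with e show ?thesis by (auto simp: A_def J_def)
        qed (use e in \<open>simp add: E'_def\<close>)
      qed
    qed (auto simp: A_def J_def E'_def)
    then show "enc (dec E) = E"
      by (simp add: A_def J_def E'_def enc_def dec_def)
    show "dec E \<in> T"
      unfolding T_def dec_def using rooted_graphs_remove_root[OF r disj E] by auto
    have AJ: "r \<notin> A \<union> J" "A \<inter> J = {}" "finite A" "finite J"
      using r disj fin by (auto simp: A_def J_def)
    have "edge_prod F E = edge_prod F ((\<lambda>j. {r, j}) ` (A \<union> J)) * edge_prod F E'"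
      unfolding star[symmetric]
    proof (rule edge_prod_union[of "R \<union> S"])
      show "(\<lambda>j. {r, j}) ` (A \<union> J) \<subseteq> Pow (R \<union> S)" using r by (auto simp: A_def J_def)
      show "E' \<subseteq> Pow (R \<union> S)" using sub by (auto simp: E'_def)
    qed (use fin in \<open>auto simp: E'_def\<close>)
    also have "\<dots> = (\<Prod>j\<in>A. F r j) * ((\<Prod>j\<in>J. F r j) * edge_prod F E')"
      using AJ by (simp add: edge_prod_star[OF AJ(1) sym] prod.union_disjoint mult.assoc)
    finally show "(\<lambda>((A, J), E). (\<Prod>j\<in>A. F r j) * ((\<Prod>j\<in>J. F r j) * edge_prod F E)) (dec E) = edge_prod F E"
      by (simp add: A_def J_def E'_def dec_def)
  next
    fix t assume "t \<in> T"
    then obtain A J E where t: "t = ((A, J), E)" and A: "A \<subseteq> R - {r}" and J: "J \<subseteq> S"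
      and E: "E \<in> rooted_graphs (R - {r} \<union> J) (S - J)" by (auto simp: T_def)
    have "r \<notin> S" using r disj by auto
    \<comment> \<open>No edge of the smaller graph touches \<open>r\<close>, so the edges at
      \<open>r\<close> in the glued graph form exactly the star; \<open>A\<close> and
      \<open>J\<close> are recovered from it because \<open>R\<close> and \<open>S\<close> are
      disjoint.\<close>
    then have noroot: "r \<notin> e" if "e \<in> E" for e
      using that E J by (auto simp: rooted_graphs_def)
    let ?E = "(\<lambda>j. {r, j}) ` (A \<union> J) \<union> E"
    have nbr: "{r, j} \<in> ?E \<longleftrightarrow> j \<in> A \<union> J" for j
      using noroot[of "{r, j}"] by (auto simp: doubleton_eq_iff)
    have "{j \<in> R - {r}. {r, j} \<in> ?E} = A" "{j \<in> S. {r, j} \<in> ?E} = J"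
      unfolding nbr using A J disj by auto
    moreover have "{e \<in> ?E. r \<notin> e} = E" using noroot by auto
    ultimately show "dec (enc t) = t"
      by (simp only: t enc_def dec_def prod.case)
    show "enc t \<in> rooted_graphs R S"
      using rooted_graphs_add_root[OF r disj A J E] by (simp add: t enc_def)
  qed
  also have "\<dots> = (\<Sum>(A, J)\<in>Pow (R - {r}) \<times> Pow S. \<Sum>E\<in>rooted_graphs (R - {r} \<union> J) (S - J).
      (\<Prod>j\<in>A. F r j) * ((\<Prod>j\<in>J. F r j) * edge_prod F E))"
    unfolding T_def using fin r
    by (subst sum.Sigma[symmetric]) (auto intro!: gfin sum.cong)
  also have "\<dots> = (\<Sum>A\<in>Pow (R - {r}). \<Sum>J\<in>Pow S. (\<Prod>j\<in>A. F r j) *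
      ((\<Prod>j\<in>J. F r j) * graph_sum F (R - {r} \<union> J) (S - J)))"
    by (simp add: sum.cartesian_product graph_sum_def sum_distrib_left)
  also have "\<dots> = (\<Sum>A\<in>Pow (R - {r}). \<Prod>j\<in>A. F r j) *
      (\<Sum>J\<in>Pow S. (\<Prod>j\<in>J. F r j) * graph_sum F (R - {r} \<union> J) (S - J))"
    by (rule sum_product[symmetric])
  also have "(\<Sum>A\<in>Pow (R - {r}). \<Prod>j\<in>A. F r j) = (\<Prod>j\<in>R - {r}. 1 + F r j)"
    using prod_add[of "R - {r}" "F r" "\<lambda>_. 1"] fin by (simp add: add.commute)
  finally show ?thesis .
qed

lemma graph_sum_no_roots:
  "graph_sum F {} S = (if S = {} then 1 else 0)"
proof (cases "S = {}")
  case True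
  then have "rooted_graphs {} S = {{}}" by (auto simp: rooted_graphs_def)
  then show ?thesis by (simp add: True graph_sum_def edge_prod_def)
next
  case False
  then have "rooted_graphs {} S = {}" by (auto simp: rooted_graphs_def)
  then show ?thesis by (simp add: False graph_sum_def)
qed

text \<open>Both sides obey the same recursion under deletion of the first root. Labels are
  distinct, but \<open>x\<close> may send several of them to one point.\<close>

lemma graph_sum_eq_rooted:
  assumes sym: "\<And>x y. f x y = f y x" and dist: "distinct (is @ js)"
  shows "graph_sum (\<lambda>i j. f (x i) (x j)) (set is) (set js) = rooted f (map x is) (map x js)"
  using dist
proof (induction "length is + length js" arbitrary: "is" js)
  case 0
  then show ?case by (simp add: graph_sum_no_roots)
next
  case (Suc n)
  let ?F = "\<lambda>i j. f (x i) (x j)"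
  show ?case
  proof (cases "is")
    case Nil
    then show ?thesis by (simp add: graph_sum_no_roots)
  next
    case (Cons i is')
    have dist: "distinct (is' @ js)" "i \<notin> set is'" "i \<notin> set js" using Suc.prems Cons by auto
    have "graph_sum ?F (set is) (set js) = (\<Prod>j\<in>set is'. 1 + ?F i j) *
      (\<Sum>J\<in>Pow (set js). (\<Prod>j\<in>J. ?F i j) * graph_sum ?F (set is' \<union> J) (set js - J))"
      using Suc.prems dist by (subst graph_sum_remove_root[of i]) (auto simp: Cons sym)
    also have "(\<Sum>J\<in>Pow (set js). (\<Prod>j\<in>J. ?F i j) * graph_sum ?F (set is' \<union> J) (set js - J))
      = split_sum js (\<lambda>us vs. (\<Prod>j\<in>set us. ?F i j) * graph_sum ?F (set is' \<union> set us) (set vs))"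
      using dist by (subst split_sum_Pow) auto
    also have "\<dots> = split_sum js (\<lambda>us vs. (\<Prod>u\<leftarrow>us. ?F i u) * rooted f (map x (us @ is')) (map x vs))"
    proof (rule split_sum_cong_mset)
      fix us vs assume m: "mset us + mset vs = mset js"
      then have "mset (us @ is' @ vs) = mset (is' @ js)" by (simp flip: m)
      then have d: "distinct (us @ is' @ vs)" using dist by (metis mset_eq_imp_distinct_iff)
      moreover have "n = length (us @ is') + length vs"
        using Suc(2) Cons arg_cong[OF m, of size] by simp
      ultimately have "graph_sum ?F (set (us @ is')) (set vs) = rooted f (map x (us @ is')) (map x vs)"
        by (intro Suc(1)) auto
      then show "(\<Prod>j\<in>set us. ?F i j) * graph_sum ?F (set is' \<union> set us) (set vs)
        = (\<Prod>u\<leftarrow>us. ?F i u) * rooted f (map x (us @ is')) (map x vs)"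
        using d by (simp add: prod.distinct_set_conv_list Un_commute)
    qed
    also have "(\<Prod>j\<in>set is'. 1 + ?F i j) = (\<Prod>j\<leftarrow>is'. 1 + ?F i j)"
      using dist by (simp add: prod.distinct_set_conv_list)
    finally show ?thesis by (simp add: Cons split_sum_map o_def)
  qed
qed

lemma psi_eq_rooted:
  assumes "\<And>x y. v x y = v y x"
  shows "psi v n (n + k) x = rooted (mayer v) (map x [0..<n]) (map x [n..<n + k])"
proof -
  have "{..<n} = set [0..<n]" "{n..<n + k} = set [n..<n + k]" by auto
  then show ?thesis
    using assms by (simp only: psi_eq_graph_sum[OF le_add1])
      (rule graph_sum_eq_rooted, auto simp: mayer_def)
qed

text \<open>The induction extends \<open>weight\<close> by a last point, whereas
  \<open>boltzmann\<close> recurses on the first; \<open>boltzmann_move\<close> brings the last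
  point to the front.\<close>

lemma weight_eq_boltzmann:
  assumes "\<And>x y. v x y = v y x"
  shows "weight v m x = boltzmann (mayer v) (map x [0..<m])"
proof (induction m)
  case (Suc m)
  have sym: "mayer v x y = mayer v y x" for x y using assms by (simp add: mayer_def)
  have fin: "finite {(i, j). i < j \<and> j < m}"
    by (rule finite_subset[of _ "{..<m} \<times> {..<m}"]) auto
  have "{(i, j). i < j \<and> j < Suc m} = {(i, j). i < j \<and> j < m} \<union> (\<lambda>i. (i, m)) ` {..<m}" by auto
  then have "weight v (Suc m) x = weight v m x * (\<Prod>p\<in>(\<lambda>i. (i, m)) ` {..<m}. case p of (i, j) \<Rightarrow> 1 + mayer v (x i) (x j))"
    unfolding weight_def by (simp only:) (rule prod.union_disjoint, auto simp: fin)
  also have "(\<Prod>p\<in>(\<lambda>i. (i, m)) ` {..<m}. case p of (i, j) \<Rightarrow> 1 + mayer v (x i) (x j))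
      = (\<Prod>i<m. 1 + mayer v (x m) (x i))"
    by (subst prod.reindex) (auto simp: inj_on_def sym)
  also have "\<dots> = (\<Prod>y\<leftarrow>map x [0..<m]. 1 + mayer v (x m) y)"
    by (simp add: prod.distinct_set_conv_list[symmetric] atLeast0LessThan o_def)
  finally show ?case
    using boltzmann_move[of "mayer v" "map x [0..<m]" "x m" "[]", OF sym] Suc.IH by simp
qed (simp add: weight_def)

section \<open>Iterated integrals over finite configurations\<close>

lemma measurable_compose3 [measurable_dest]:
  assumes f: "(\<lambda>(x, y, z). f x y z) \<in> measurable (M1 \<Otimes>\<^sub>M (M2 \<Otimes>\<^sub>M M3)) N"
    and "a \<in> measurable M M1" "b \<in> measurable M M2" "c \<in> measurable M M3"
  shows "(\<lambda>x. f (a x) (b x) (c x)) \<in> measurable M N"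
  using measurable_compose[OF measurable_Pair[OF assms(2) measurable_Pair[OF assms(3,4)]] f] by simp

text \<open>Finite configurations are encoded as lists, with the sigma-algebra generated by the length and
  the entries, so that concatenation and removal of points need no reindexing of product measures.\<close>
definition pad :: "'a list \<Rightarrow> nat \<Rightarrow> 'a" where
  "pad l i = (if i < length l then l ! i else undefined)"

definition list_borel :: "'a::topological_space list measure" where
  "list_borel = vimage_algebra UNIV (\<lambda>l. (length l, pad l)) (count_space UNIV \<Otimes>\<^sub>M PiM UNIV (\<lambda>_. borel))"

lemma space_list_borel [simp]: "space list_borel = UNIV"
  by (simp add: list_borel_def)

lemma measurable_list_borelI:
  assumes "(\<lambda>x. length (h x)) \<in> measurable N (count_space UNIV)"
    and "\<And>i. (\<lambda>x. pad (h x) i) \<in> borel_measurable N"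
  shows "h \<in> measurable N list_borel"
  unfolding list_borel_def
proof (rule measurable_vimage_algebra2)
  have "(\<lambda>x. pad (h x)) \<in> measurable N (PiM UNIV (\<lambda>_. borel))"
    using assms(2) by (intro measurable_PiM_single') auto
  with assms(1) show "(\<lambda>x. (length (h x), pad (h x))) \<in> measurable N (count_space UNIV \<Otimes>\<^sub>M PiM UNIV (\<lambda>_. borel))"
    by measurable
qed simp

lemma measurable_length_pad:
  "(\<lambda>l. (length l, pad l)) \<in> measurable list_borel (count_space UNIV \<Otimes>\<^sub>M PiM UNIV (\<lambda>_. borel))"
  unfolding list_borel_def by (rule measurable_vimage_algebra1) (auto simp: space_pair_measure space_PiM)

lemma measurable_length_list_borel [measurable]: "length \<in> measurable list_borel (count_space UNIV)"
  using measurable_compose[OF measurable_length_pad measurable_fst] by simp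

lemma measurable_pad [measurable]: "pad \<in> measurable list_borel (PiM UNIV (\<lambda>_. borel))"
  using measurable_compose[OF measurable_length_pad measurable_snd] by simp

lemma map_pad: "map (pad l) [0..<length l] = l"
  by (rule nth_equalityI) (auto simp: pad_def)

lemma measurable_pad_nth [measurable (raw)]:
  assumes [measurable]: "h \<in> measurable N list_borel"
  shows "(\<lambda>x. pad (h x) i) \<in> borel_measurable N"
  by (rule measurable_compose[OF _ measurable_component_singleton[of i UNIV "\<lambda>_. borel"]]) auto

lemma measurable_Nil [measurable]: "(\<lambda>_. []) \<in> measurable N list_borel"
  by (rule measurable_const) simp

lemma measurable_Cons_list [measurable (raw)]:
  assumes [measurable]: "f \<in> borel_measurable N" "g \<in> measurable N list_borel"
  shows "(\<lambda>x. f x # g x) \<in> measurable N list_borel"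
proof (rule measurable_list_borelI)
  fix i
  have "(\<lambda>x. pad (f x # g x) i) = (case i of 0 \<Rightarrow> f | Suc j \<Rightarrow> (\<lambda>x. pad (g x) j))"
    by (auto simp: pad_def split: nat.split)
  then show "(\<lambda>x. pad (f x # g x) i) \<in> borel_measurable N"
    by (cases i) auto
qed simp

lemma measurable_append_list [measurable (raw)]:
  assumes [measurable]: "f \<in> measurable N list_borel" "g \<in> measurable N list_borel"
  shows "(\<lambda>x. f x @ g x) \<in> measurable N list_borel"
proof (rule measurable_list_borelI)
  fix i
  have "(\<lambda>x. (\<lambda>k x. if i < k then pad (f x) i else pad (g x) (i - k)) (length (f x)) x) \<in> borel_measurable N"
    by (rule measurable_compose_countable) (auto split: if_split)
  also have "(\<lambda>x. (\<lambda>k x. if i < k then pad (f x) i else pad (g x) (i - k)) (length (f x)) x) = (\<lambda>x. pad (f x @ g x) i)"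
    by (auto simp: pad_def nth_append fun_eq_iff)
  finally show "(\<lambda>x. pad (f x @ g x) i) \<in> borel_measurable N" .
qed simp

lemma measurable_map_list:
  assumes "\<And>i. i \<in> set is \<Longrightarrow> (\<lambda>x. h x i) \<in> borel_measurable N"
  shows "(\<lambda>x. map (h x) is) \<in> measurable N list_borel"
  using assms by (induction "is") auto

text \<open>The length takes countably many values, so it suffices to treat each fixed
  \<open>k\<close>, where the list is a tuple of \<open>k\<close> measurable coordinates; the slice
  with \<open>k = length (Y x)\<close> is \<open>Y x\<close> itself.\<close>

lemma measurable_list_slices:
  assumes Y [measurable]: "Y \<in> measurable N list_borel"
    and g: "\<And>k. (\<lambda>x. g x (map (pad (Y x)) [0..<k])) \<in> measurable N L"
  shows "(\<lambda>x. g x (Y x)) \<in> measurable N L"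
proof -
  have "(\<lambda>x. (\<lambda>k x. g x (map (pad (Y x)) [0..<k])) (length (Y x)) x) \<in> measurable N L"
    by (rule measurable_compose_countable) (auto intro: g)
  then show ?thesis by (simp add: map_pad)
qed

text \<open>Splitting a fixed list of indices, rather than the varying points, leaves a finite sum
  whose range does not depend on \<open>x\<close>.\<close>

lemma borel_measurable_split_sum_nat:
  fixes B :: "'w \<Rightarrow> 'i list \<Rightarrow> 'i list \<Rightarrow> 'b::{second_countable_topology, topological_comm_monoid_add}"
  assumes "\<And>us vs. length us + length vs = length is \<Longrightarrow> (\<lambda>x. B x us vs) \<in> borel_measurable N"
  shows "(\<lambda>x. split_sum is (B x)) \<in> borel_measurable N"
  using assms by (induction "is" arbitrary: B) auto

lemma borel_measurable_split_sum [measurable (raw)]: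
  fixes A :: "'w \<Rightarrow> 'a::topological_space list \<Rightarrow> 'a list \<Rightarrow> 'b::{second_countable_topology, topological_comm_monoid_add}"
  assumes [measurable]: "(\<lambda>(x, us, vs). A x us vs) \<in> borel_measurable (N \<Otimes>\<^sub>M (list_borel \<Otimes>\<^sub>M list_borel))"
    and Y [measurable]: "Y \<in> measurable N list_borel"
  shows "(\<lambda>x. split_sum (Y x) (A x)) \<in> borel_measurable N"
proof (rule measurable_list_slices[OF Y])
  fix k
  have [measurable]: "(\<lambda>x. map (pad (Y x)) is) \<in> measurable N list_borel" for "is"
    by (rule measurable_map_list) measurable
  show "(\<lambda>x. split_sum (map (pad (Y x)) [0..<k]) (A x)) \<in> borel_measurable N"
    unfolding split_sum_map by (rule borel_measurable_split_sum_nat) measurable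
qed

lemma borel_measurable_pick_sum_nat:
  fixes B :: "'w \<Rightarrow> 'i \<Rightarrow> 'i list \<Rightarrow> 'b::{second_countable_topology, topological_comm_monoid_add}"
  assumes "\<And>u us. (\<lambda>x. B x u us) \<in> borel_measurable N"
  shows "(\<lambda>x. pick_sum is (B x)) \<in> borel_measurable N"
  using assms by (induction "is" arbitrary: B) auto

lemma borel_measurable_pick_sum [measurable (raw)]:
  fixes A :: "'w \<Rightarrow> 'a::topological_space \<Rightarrow> 'a list \<Rightarrow> 'b::{second_countable_topology, topological_comm_monoid_add}"
  assumes [measurable]: "(\<lambda>(x, u, us). A x u us) \<in> borel_measurable (N \<Otimes>\<^sub>M (borel \<Otimes>\<^sub>M list_borel))"
    and Y [measurable]: "Y \<in> measurable N list_borel"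
  shows "(\<lambda>x. pick_sum (Y x) (A x)) \<in> borel_measurable N"
proof (rule measurable_list_slices[OF Y])
  fix k
  have [measurable]: "(\<lambda>x. map (pad (Y x)) is) \<in> measurable N list_borel" for "is"
    by (rule measurable_map_list) measurable
  show "(\<lambda>x. pick_sum (map (pad (Y x)) [0..<k]) (A x)) \<in> borel_measurable N"
    unfolding pick_sum_map by (rule borel_measurable_pick_sum_nat) measurable
qed

lemma borel_measurable_fact_sum_nat:
  fixes B :: "'w \<Rightarrow> 'i list \<Rightarrow> 'i list \<Rightarrow> 'b::{second_countable_topology, topological_comm_monoid_add}"
  assumes "\<And>us vs. (\<lambda>x. B x us vs) \<in> borel_measurable N"
  shows "(\<lambda>x. fact_sum n is (B x)) \<in> borel_measurable N"
  using assms by (induction n arbitrary: "is" B) (auto intro!: borel_measurable_pick_sum_nat)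

lemma borel_measurable_fact_sum [measurable (raw)]:
  fixes A :: "'w \<Rightarrow> 'a::topological_space list \<Rightarrow> 'a list \<Rightarrow> 'b::{second_countable_topology, topological_comm_monoid_add}"
  assumes [measurable]: "(\<lambda>(x, us, vs). A x us vs) \<in> borel_measurable (N \<Otimes>\<^sub>M (list_borel \<Otimes>\<^sub>M list_borel))"
    and Y [measurable]: "Y \<in> measurable N list_borel"
  shows "(\<lambda>x. fact_sum n (Y x) (A x)) \<in> borel_measurable N"
proof (rule measurable_list_slices[OF Y])
  fix k
  have [measurable]: "(\<lambda>x. map (pad (Y x)) is) \<in> measurable N list_borel" for "is"
    by (rule measurable_map_list) measurable
  show "(\<lambda>x. fact_sum n (map (pad (Y x)) [0..<k]) (A x)) \<in> borel_measurable N"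
    unfolding fact_sum_map by (rule borel_measurable_fact_sum_nat) measurable
qed

lemma borel_measurable_prod_list_map [measurable (raw)]:
  fixes g :: "'w \<Rightarrow> 'a::topological_space \<Rightarrow> real"
  assumes [measurable]: "(\<lambda>(x, y). g x y) \<in> borel_measurable (N \<Otimes>\<^sub>M borel)"
    and Y [measurable]: "Y \<in> measurable N list_borel"
  shows "(\<lambda>x. \<Prod>y\<leftarrow>Y x. g x y) \<in> borel_measurable N"
proof (rule measurable_list_slices[OF Y])
  fix k
  have "(\<lambda>x. \<Prod>y\<leftarrow>map (pad (Y x)) is. g x y) \<in> borel_measurable N" for "is"
    by (induction "is") auto
  then show "(\<lambda>x. \<Prod>y\<leftarrow>map (pad (Y x)) [0..<k]. g x y) \<in> borel_measurable N" .
qed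

lemma borel_measurable_rooted_nat:
  fixes f :: "'a::topological_space \<Rightarrow> 'a \<Rightarrow> real"
  assumes f [measurable]: "case_prod f \<in> borel_measurable (borel \<Otimes>\<^sub>M borel)"
    and h: "\<And>i. (\<lambda>x. h x i) \<in> borel_measurable N"
  shows "(\<lambda>x. rooted f (map (h x) is) (map (h x) js)) \<in> borel_measurable N"
proof (induction "length is + length js" arbitrary: "is" js)
  case 0
  then show ?case by simp
next
  case (Suc n)
  note h[measurable] measurable_map_list[OF h, measurable]
  show ?case
  proof (cases "is")
    case (Cons i is')
    have "(\<lambda>x. \<Prod>u\<leftarrow>map (h x) us. f (h x i) u) \<in> borel_measurable N" for us by measurable
    moreover have "(\<lambda>x. rooted f (map (h x) (us @ is')) (map (h x) vs)) \<in> borel_measurable N"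
      if "length us + length vs = length js" for us vs
      using that Suc(2) Cons by (intro Suc(1)) simp
    ultimately have "(\<lambda>x. split_sum js (\<lambda>us vs. (\<Prod>u\<leftarrow>map (h x) us. f (h x i) u) *
        rooted f (map (h x) us @ map (h x) is') (map (h x) vs))) \<in> borel_measurable N"
      by (intro borel_measurable_split_sum_nat) simp
    moreover have "(\<lambda>x. \<Prod>y\<leftarrow>map (h x) is'. 1 + f (h x i) y) \<in> borel_measurable N"
      by measurable
    ultimately show ?thesis unfolding Cons list.map rooted.simps split_sum_map
      by (rule borel_measurable_times[rotated])
  qed simp
qed

text \<open>Both lengths are sliced at once: for fixed lengths, roots and non-roots are coordinates
  of the concatenation with fixed index lists.\<close>

lemma borel_measurable_rooted:
  fixes f :: "'a::topological_space \<Rightarrow> 'a \<Rightarrow> real"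
  assumes f [measurable]: "case_prod f \<in> borel_measurable (borel \<Otimes>\<^sub>M borel)"
    and [measurable]: "X \<in> measurable N list_borel" "Y \<in> measurable N list_borel"
  shows "(\<lambda>x. rooted f (X x) (Y x)) \<in> borel_measurable N"
proof -
  have *: "(\<lambda>x. rooted f (map (pad (X x @ Y x)) is) (map (pad (X x @ Y x)) js)) \<in> borel_measurable N" for "is" js
    by (rule borel_measurable_rooted_nat[OF f]) measurable
  have "(\<lambda>x. (\<lambda>k x. rooted f (map (pad (X x @ Y x)) [0..<k]) (map (pad (X x @ Y x)) [k..<k + m]))
      (length (X x)) x) \<in> borel_measurable N" for m
    by (rule measurable_compose_countable) (rule *, measurable)
  then have "(\<lambda>x. (\<lambda>m x. (\<lambda>k x. rooted f (map (pad (X x @ Y x)) [0..<k]) (map (pad (X x @ Y x)) [k..<k + m]))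
      (length (X x)) x) (length (Y x)) x) \<in> borel_measurable N"
    by (rule measurable_compose_countable) measurable
  moreover have "map (pad (l @ l')) [0..<length l] = l"
    "map (pad (l @ l')) [length l..<length l + length l'] = l'" for l l' :: "'a list"
    by (auto intro!: nth_equalityI simp: pad_def nth_append)
  ultimately show ?thesis by (simp only:)
qed

lemma borel_measurable_boltzmann:
  fixes f :: "'a::topological_space \<Rightarrow> 'a \<Rightarrow> real"
  assumes "case_prod f \<in> borel_measurable (borel \<Otimes>\<^sub>M borel)" "X \<in> measurable N list_borel"
  shows "(\<lambda>x. boltzmann f (X x)) \<in> borel_measurable N"
  using borel_measurable_rooted[OF assms measurable_Nil] by (simp add: rooted_Nil2)

section \<open>Iterated integrals, with the last point innermost, and Poisson sums\<close>

primrec iter_int :: "'a measure \<Rightarrow> nat \<Rightarrow> ('a list \<Rightarrow> ennreal) \<Rightarrow> ennreal" where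
  "iter_int M 0 g = g []"
| "iter_int M (Suc k) g = iter_int M k (\<lambda>ys. \<integral>\<^sup>+ y. g (ys @ [y]) \<partial>M)"

text \<open>The exceptional null set is avoided one coordinate at a time, so the comparison is only
  required on lists with all entries in \<open>G\<close>.\<close>

lemma iter_int_mono_AE:
  assumes "AE y in M. y \<in> G"
    and "\<And>ys. length ys = k \<Longrightarrow> set ys \<subseteq> G \<Longrightarrow> g ys \<le> h ys"
  shows "iter_int M k g \<le> iter_int M k h"
  using assms(2)
proof (induction k arbitrary: g h)
  case (Suc k)
  have "(\<integral>\<^sup>+ y. g (ys @ [y]) \<partial>M) \<le> (\<integral>\<^sup>+ y. h (ys @ [y]) \<partial>M)"
    if "length ys = k" "set ys \<subseteq> G" for ys
    by (rule nn_integral_mono_AE, rule AE_mp[OF assms(1)]) (use that in \<open>auto intro!: AE_I2 Suc.prems\<close>)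
  then show ?case by (auto intro: Suc.IH)
qed simp

lemma iter_int_mono:
  assumes "\<And>ys. length ys = k \<Longrightarrow> g ys \<le> h ys"
  shows "iter_int M k g \<le> iter_int M k h"
  by (rule iter_int_mono_AE[where G = UNIV]) (auto intro: assms)

lemma iter_int_cong:
  assumes "\<And>ys. length ys = k \<Longrightarrow> g ys = h ys"
  shows "iter_int M k g = iter_int M k h"
  by (intro antisym iter_int_mono) (auto simp: assms)

lemma iter_int_const: "iter_int M k (\<lambda>_. c) = c * emeasure M (space M) ^ k"
  by (induction k arbitrary: c) (auto simp: mult_ac)

text \<open>Poisson expectation up to the factor \<open>exp (- M (space M))\<close>, which cancels in Gibbs expectations.\<close>
definition poisson_int :: "'a measure \<Rightarrow> ('a list \<Rightarrow> ennreal) \<Rightarrow> ennreal" where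
  "poisson_int M g = (\<Sum>k. ennreal (1 / fact k) * iter_int M k g)"

lemma poisson_int_mono_AE:
  assumes "AE y in M. y \<in> G" "\<And>ys. set ys \<subseteq> G \<Longrightarrow> g ys \<le> h ys"
  shows "poisson_int M g \<le> poisson_int M h"
  unfolding poisson_int_def
  by (intro suminf_le mult_left_mono iter_int_mono_AE[OF assms(1)] assms(2)) auto

lemma poisson_int_mono:
  assumes "\<And>ys. g ys \<le> h ys"
  shows "poisson_int M g \<le> poisson_int M h"
  by (rule poisson_int_mono_AE[where G = UNIV]) (auto intro: assms)

lemma suminf_ennreal_swap:
  fixes b :: "nat \<Rightarrow> nat \<Rightarrow> ennreal"
  shows "(\<Sum>k. \<Sum>j. b k j) = (\<Sum>j. \<Sum>k. b k j)"
proof -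
  have "(\<Sum>k. \<Sum>j. b k j) = (\<integral>\<^sup>+ k. (\<Sum>j. b k j) \<partial>count_space UNIV)"
    by (rule nn_integral_count_space_nat[symmetric])
  also have "\<dots> = (\<Sum>j. \<integral>\<^sup>+ k. b k j \<partial>count_space UNIV)"
    by (rule nn_integral_suminf) simp
  finally show ?thesis by (simp add: nn_integral_count_space_nat)
qed

text \<open>Extending the terms by zero for \<open>j > k\<close> makes both ranges independent, so
  the order can be exchanged; shifting by \<open>j\<close> removes the zeros again.\<close>

lemma suminf_ennreal_Cauchy:
  fixes b :: "nat \<Rightarrow> nat \<Rightarrow> ennreal"
  shows "(\<Sum>k. \<Sum>j\<le>k. b j (k - j)) = (\<Sum>j. \<Sum>l. b j l)"
proof -
  let ?c = "\<lambda>j k. if j \<le> k then b j (k - j) else 0"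
  have "(\<Sum>k. \<Sum>j\<le>k. b j (k - j)) = (\<Sum>k. \<Sum>j. ?c j k)"
  proof (rule suminf_cong)
    fix k
    show "(\<Sum>j\<le>k. b j (k - j)) = (\<Sum>j. ?c j k)"
      by (subst suminf_finite[of "{..k}"]) (auto intro!: sum.cong)
  qed
  also have "\<dots> = (\<Sum>j. \<Sum>k. ?c j k)"
    by (rule suminf_ennreal_swap)
  also have "\<dots> = (\<Sum>j. \<Sum>l. b j l)"
  proof (rule suminf_cong)
    fix j
    have "(\<Sum>k. ?c j k) = (\<Sum>l. ?c j (l + j)) + (\<Sum>k<j. ?c j k)"
      by (rule suminf_offset) auto
    then show "(\<Sum>k. ?c j k) = (\<Sum>l. b j l)" by simp
  qed
  finally show ?thesis .
qed

section \<open>Fubini, binomial splitting and the Mecke formula\<close>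

locale borel_sigma_finite = sigma_finite_measure M for M :: "'a::topological_space measure" +
  assumes sets_M [measurable_cong]: "sets M = sets borel"
begin

lemma space_M [simp]: "space M = UNIV"
  using sets_eq_imp_space_eq[OF sets_M] by simp

lemma pair_sf: "pair_sigma_finite M M" ..

lemma borel_measurable_iter_int [measurable (raw)]:
  assumes "(\<lambda>(x, ys). g x ys) \<in> borel_measurable (N \<Otimes>\<^sub>M list_borel)"
  shows "(\<lambda>x. iter_int M k (g x)) \<in> borel_measurable N"
  using assms
proof (induction k arbitrary: g)
  case (Suc k)
  note [measurable] = Suc.prems
  have "(\<lambda>(x, ys). \<integral>\<^sup>+ y. g x (ys @ [y]) \<partial>M) \<in> borel_measurable (N \<Otimes>\<^sub>M list_borel)"
    by measurable
  then show ?case by (simp add: Suc.IH)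
qed simp

lemma iter_int_add:
  assumes "g \<in> borel_measurable list_borel" "h \<in> borel_measurable list_borel"
  shows "iter_int M k (\<lambda>ys. g ys + h ys) = iter_int M k g + iter_int M k h"
  using assms
proof (induction k arbitrary: g h)
  case (Suc k)
  note [measurable] = Suc.prems
  have "iter_int M (Suc k) (\<lambda>ys. g ys + h ys)
      = iter_int M k (\<lambda>ys. (\<integral>\<^sup>+ y. g (ys @ [y]) \<partial>M) + (\<integral>\<^sup>+ y. h (ys @ [y]) \<partial>M))"
    by (simp add: nn_integral_add)
  also have "\<dots> = iter_int M (Suc k) g + iter_int M (Suc k) h"
    by (subst Suc.IH) auto
  finally show ?case .
qed simp

lemma iter_int_cmult:
  assumes "g \<in> borel_measurable list_borel"
  shows "iter_int M k (\<lambda>ys. c * g ys) = c * iter_int M k g"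
  using assms
proof (induction k arbitrary: g)
  case (Suc k)
  note [measurable] = Suc.prems
  have "iter_int M (Suc k) (\<lambda>ys. c * g ys) = iter_int M k (\<lambda>ys. c * (\<integral>\<^sup>+ y. g (ys @ [y]) \<partial>M))"
    by (simp add: nn_integral_cmult)
  also have "\<dots> = c * iter_int M (Suc k) g"
    by (subst Suc.IH) auto
  finally show ?case .
qed simp

lemma iter_int_suminf:
  assumes "\<And>i. g i \<in> borel_measurable list_borel"
  shows "iter_int M k (\<lambda>ys. \<Sum>i. g i ys) = (\<Sum>i. iter_int M k (g i))"
  using assms
proof (induction k arbitrary: g)
  case (Suc k)
  note [measurable] = Suc.prems
  have "iter_int M (Suc k) (\<lambda>ys. \<Sum>i. g i ys) = iter_int M k (\<lambda>ys. \<Sum>i. (\<integral>\<^sup>+ y. g i (ys @ [y]) \<partial>M))"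
    by (simp add: nn_integral_suminf)
  also have "\<dots> = (\<Sum>i. iter_int M (Suc k) (g i))"
    by (subst Suc.IH) auto
  finally show ?case .
qed simp

lemma iter_int_swap:
  assumes "(\<lambda>(y, ys). g y ys) \<in> borel_measurable (borel \<Otimes>\<^sub>M list_borel)"
  shows "iter_int M k (\<lambda>ys. \<integral>\<^sup>+ y. g y ys \<partial>M) = (\<integral>\<^sup>+ y. iter_int M k (g y) \<partial>M)"
  using assms
proof (induction k arbitrary: g)
  case (Suc k)
  note [measurable] = Suc.prems
  have "iter_int M (Suc k) (\<lambda>ys. \<integral>\<^sup>+ y. g y ys \<partial>M)
      = iter_int M k (\<lambda>ys. \<integral>\<^sup>+ y. \<integral>\<^sup>+ w. g y (ys @ [w]) \<partial>M \<partial>M)"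
    unfolding iter_int.simps
    by (rule iter_int_cong, rule pair_sigma_finite.Fubini'[OF pair_sf]) measurable
  also have "\<dots> = (\<integral>\<^sup>+ y. iter_int M (Suc k) (g y) \<partial>M)"
    by (subst Suc.IH) auto
  finally show ?case .
qed simp

text \<open>Iterated integrals peel points off the end, list recursions off the head; Fubini
  reconciles the two.\<close>

lemma iter_int_Cons:
  assumes "g \<in> borel_measurable list_borel"
  shows "iter_int M (Suc k) g = iter_int M k (\<lambda>ys. \<integral>\<^sup>+ y. g (y # ys) \<partial>M)"
  using assms
proof (induction k arbitrary: g)
  case (Suc k)
  note [measurable] = Suc.prems
  have "iter_int M (Suc (Suc k)) g = iter_int M (Suc k) (\<lambda>ys. \<integral>\<^sup>+ y. g (ys @ [y]) \<partial>M)" by simp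
  also have "\<dots> = iter_int M k (\<lambda>ys. \<integral>\<^sup>+ w. \<integral>\<^sup>+ y. g (w # ys @ [y]) \<partial>M \<partial>M)"
    by (subst Suc.IH) auto
  also have "\<dots> = iter_int M (Suc k) (\<lambda>ys. \<integral>\<^sup>+ w. g (w # ys) \<partial>M)"
    unfolding iter_int.simps append_Cons
    by (rule iter_int_cong, rule pair_sigma_finite.Fubini'[OF pair_sf]) measurable
  finally show ?case .
qed simp

lemma iter_int_Cons':
  assumes [measurable]: "g \<in> borel_measurable list_borel"
  shows "iter_int M (Suc k) g = (\<integral>\<^sup>+ y. iter_int M k (\<lambda>ys. g (y # ys)) \<partial>M)"
  by (subst iter_int_Cons[OF assms], rule iter_int_swap) measurable

lemma iter_int_eq_PiM:
  assumes "g \<in> borel_measurable list_borel"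
  shows "iter_int M k g = (\<integral>\<^sup>+ x. g (map x [0..<k]) \<partial>PiM {..<k} (\<lambda>_. M))"
  using assms
proof (induction k arbitrary: g)
  case 0
  interpret product_sigma_finite "\<lambda>_::nat. M" ..
  show ?case by (simp add: PiM_empty nn_integral_count_space_finite)
next
  case (Suc k)
  note [measurable] = Suc.prems
  interpret product_sigma_finite "\<lambda>_::nat. M" ..
  have [measurable]: "(\<lambda>x. map x [0..<m]) \<in> measurable (PiM {..<m} (\<lambda>_. M)) list_borel" for m
    by (rule measurable_map_list) auto
  have "iter_int M (Suc k) g = (\<integral>\<^sup>+ x. \<integral>\<^sup>+ y. g (map x [0..<k] @ [y]) \<partial>M \<partial>PiM {..<k} (\<lambda>_. M))"
    by (simp add: Suc.IH)
  also have "\<dots> = (\<integral>\<^sup>+ x. \<integral>\<^sup>+ y. g (map (x(k := y)) [0..<Suc k]) \<partial>M \<partial>PiM {..<k} (\<lambda>_. M))"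
    by (intro nn_integral_cong arg_cong[where f = g]) auto
  also have "\<dots> = (\<integral>\<^sup>+ x. g (map x [0..<Suc k]) \<partial>PiM (insert k {..<k}) (\<lambda>_. M))"
  proof (rule product_nn_integral_insert[symmetric])
    have "(\<lambda>x. g (map x [0..<Suc k])) \<in> borel_measurable (PiM {..<Suc k} (\<lambda>_. M))"
      by (rule measurable_compose[OF _ Suc.prems]) measurable
    then show "(\<lambda>x. g (map x [0..<Suc k])) \<in> borel_measurable (PiM (insert k {..<k}) (\<lambda>_. M))"
      by (simp add: lessThan_Suc)
  qed auto
  finally show ?case by (simp add: lessThan_Suc)
qed

lemma nn_integral_split_sum:
  assumes "(\<lambda>(y, us, vs). A y us vs) \<in> borel_measurable (borel \<Otimes>\<^sub>M (list_borel \<Otimes>\<^sub>M list_borel))"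
  shows "(\<integral>\<^sup>+ y. split_sum ys (A y) \<partial>M) = split_sum ys (\<lambda>us vs. \<integral>\<^sup>+ y. A y us vs \<partial>M)"
  using assms
proof (induction ys arbitrary: A)
  case (Cons u ys)
  note [measurable] = Cons.prems
  have 1: "(\<lambda>(y, us, vs). A y (u # us) vs) \<in> borel_measurable (borel \<Otimes>\<^sub>M (list_borel \<Otimes>\<^sub>M list_borel))"
    and 2: "(\<lambda>(y, us, vs). A y us (u # vs)) \<in> borel_measurable (borel \<Otimes>\<^sub>M (list_borel \<Otimes>\<^sub>M list_borel))"
    by measurable
  have "(\<integral>\<^sup>+ y. split_sum (u # ys) (A y) \<partial>M) = (\<integral>\<^sup>+ y. split_sum ys (\<lambda>us vs. A y (u # us) vs) \<partial>M)
      + (\<integral>\<^sup>+ y. split_sum ys (\<lambda>us vs. A y us (u # vs)) \<partial>M)"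
    unfolding split_sum.simps by (rule nn_integral_add) measurable
  then show ?case by (simp add: Cons.IH[OF 1] Cons.IH[OF 2])
qed simp

lemma nn_integral_pick_sum:
  assumes "(\<lambda>(y, us, vs). A y us vs) \<in> borel_measurable (borel \<Otimes>\<^sub>M (borel \<Otimes>\<^sub>M list_borel))"
  shows "(\<integral>\<^sup>+ y. pick_sum ys (A y) \<partial>M) = pick_sum ys (\<lambda>us vs. \<integral>\<^sup>+ y. A y us vs \<partial>M)"
  using assms
proof (induction ys arbitrary: A)
  case (Cons u ys)
  note [measurable] = Cons.prems
  have 2: "(\<lambda>(y, us, vs). A y us (u # vs)) \<in> borel_measurable (borel \<Otimes>\<^sub>M (borel \<Otimes>\<^sub>M list_borel))"
    by measurable
  have "(\<integral>\<^sup>+ y. pick_sum (u # ys) (A y) \<partial>M) = (\<integral>\<^sup>+ y. A y u ys \<partial>M)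
      + (\<integral>\<^sup>+ y. pick_sum ys (\<lambda>us vs. A y us (u # vs)) \<partial>M)"
    unfolding pick_sum.simps by (rule nn_integral_add) measurable
  then show ?case by (simp add: Cons.IH[OF 2])
qed simp

text \<open>By symmetry of the product measure, all \<open>k choose j\<close> choices of positions
  for \<open>us\<close> give the same integral. In the induction the first point joins
  \<open>us\<close> or \<open>vs\<close>, and Pascal's rule adds the two cases.\<close>

lemma iter_int_split_sum:
  assumes "(\<lambda>(us, vs). A us vs) \<in> borel_measurable (list_borel \<Otimes>\<^sub>M list_borel)"
  shows "iter_int M k (\<lambda>ys. split_sum ys A)
    = (\<Sum>j\<le>k. of_nat (k choose j) * iter_int M j (\<lambda>us. iter_int M (k - j) (A us)))"
  using assms
proof (induction k arbitrary: A)
  case (Suc k)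
  note [measurable] = Suc.prems
  define c where "c = (\<lambda>j l. iter_int M j (\<lambda>us. iter_int M l (A us)))"
  have "iter_int M (Suc k) (\<lambda>ys. split_sum ys A)
      = iter_int M k (\<lambda>ys. split_sum ys (\<lambda>us vs. \<integral>\<^sup>+ y. A (y # us) vs \<partial>M))
        + iter_int M k (\<lambda>ys. split_sum ys (\<lambda>us vs. \<integral>\<^sup>+ y. A us (y # vs) \<partial>M))"
    by (subst iter_int_Cons) (auto simp: nn_integral_add nn_integral_split_sum iter_int_add)
  also have "iter_int M k (\<lambda>ys. split_sum ys (\<lambda>us vs. \<integral>\<^sup>+ y. A (y # us) vs \<partial>M))
      = (\<Sum>j\<le>k. of_nat (k choose j) * c (Suc j) (k - j))"
    unfolding c_def
    by (subst Suc.IH) (auto simp: iter_int_Cons iter_int_swap simp del: iter_int.simps)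
  also have "iter_int M k (\<lambda>ys. split_sum ys (\<lambda>us vs. \<integral>\<^sup>+ y. A us (y # vs) \<partial>M))
      = (\<Sum>j\<le>k. of_nat (k choose j) * c j (Suc (k - j)))"
    unfolding c_def
    by (subst Suc.IH) (auto simp: iter_int_Cons simp del: iter_int.simps)
  also have "(\<Sum>j\<le>k. of_nat (k choose j) * c (Suc j) (k - j)) + (\<Sum>j\<le>k. of_nat (k choose j) * c j (Suc (k - j)))
      = (\<Sum>j\<le>Suc k. of_nat (Suc k choose j) * c j (Suc k - j))"
  proof -
    \<comment> \<open>The added term \<open>j = Suc k\<close> vanishes because
      \<open>k choose Suc k = 0\<close>; splitting off \<open>j = 0\<close> then aligns the indices
      with those of the other sum.\<close>
    have "(\<Sum>j\<le>k. of_nat (k choose j) * c j (Suc (k - j))) = (\<Sum>j\<le>Suc k. of_nat (k choose j) * c j (Suc k - j))"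
      by (simp add: Suc_diff_le cong: sum.cong_simp)
    also have "\<dots> = c 0 (Suc k) + (\<Sum>j\<le>k. of_nat (k choose Suc j) * c (Suc j) (k - j))"
      by (subst sum.atMost_Suc_shift) simp
    finally show ?thesis
      by (subst sum.atMost_Suc_shift) (simp add: sum.distrib distrib_right add_ac)
  qed
  finally show ?case by (simp add: c_def)
qed simp

text \<open>Each of the \<open>Suc k\<close> positions of the picked point contributes the same
  integral.\<close>

lemma iter_int_pick_sum:
  assumes "(\<lambda>(u, us). B u us) \<in> borel_measurable (borel \<Otimes>\<^sub>M list_borel)"
  shows "iter_int M (Suc k) (\<lambda>ys. pick_sum ys B) = of_nat (Suc k) * (\<integral>\<^sup>+ u. iter_int M k (B u) \<partial>M)"
  using assms
proof (induction k arbitrary: B)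
  case (Suc k)
  note [measurable] = Suc.prems
  have "iter_int M (Suc (Suc k)) (\<lambda>ys. pick_sum ys B)
      = iter_int M (Suc k) (\<lambda>ys. \<integral>\<^sup>+ y. B y ys \<partial>M)
        + iter_int M (Suc k) (\<lambda>ys. pick_sum ys (\<lambda>u us. \<integral>\<^sup>+ y. B u (y # us) \<partial>M))"
    by (subst iter_int_Cons) (auto simp: nn_integral_add nn_integral_pick_sum iter_int_add simp del: iter_int.simps)
  also have "iter_int M (Suc k) (\<lambda>ys. \<integral>\<^sup>+ y. B y ys \<partial>M) = (\<integral>\<^sup>+ u. iter_int M (Suc k) (B u) \<partial>M)"
    by (rule iter_int_swap) measurable
  also have "iter_int M (Suc k) (\<lambda>ys. pick_sum ys (\<lambda>u us. \<integral>\<^sup>+ y. B u (y # us) \<partial>M))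
      = of_nat (Suc k) * (\<integral>\<^sup>+ u. iter_int M (Suc k) (B u) \<partial>M)"
    by (subst Suc.IH) (auto simp: iter_int_Cons simp del: iter_int.simps)
  finally show ?case by (simp add: distrib_right del: iter_int.simps)
qed simp

lemma borel_measurable_poisson_int [measurable (raw)]:
  assumes [measurable]: "(\<lambda>(x, ys). g x ys) \<in> borel_measurable (N \<Otimes>\<^sub>M list_borel)"
  shows "(\<lambda>x. poisson_int M (g x)) \<in> borel_measurable N"
  unfolding poisson_int_def by measurable

lemma poisson_int_add:
  assumes "g \<in> borel_measurable list_borel" "h \<in> borel_measurable list_borel"
  shows "poisson_int M (\<lambda>ys. g ys + h ys) = poisson_int M g + poisson_int M h"
  by (simp add: poisson_int_def iter_int_add[OF assms] distrib_left suminf_add)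

lemma poisson_int_cmult:
  assumes "g \<in> borel_measurable list_borel"
  shows "poisson_int M (\<lambda>ys. c * g ys) = c * poisson_int M g"
  by (simp add: poisson_int_def iter_int_cmult[OF assms] mult.left_commute flip: ennreal_suminf_cmult)

text \<open>The binomial coefficient cancels against \<open>1 / fact k\<close> and leaves
  \<open>1 / fact j\<close> times \<open>1 / fact (k - j)\<close>, so the sum is a Cauchy product.
  This is what separates \<psi> from the partition function.\<close>

lemma poisson_int_split_sum:
  assumes [measurable]: "(\<lambda>(us, vs). A us vs) \<in> borel_measurable (list_borel \<Otimes>\<^sub>M list_borel)"
  shows "poisson_int M (\<lambda>ys. split_sum ys A) = poisson_int M (\<lambda>us. poisson_int M (A us))"
proof -
  define c where "c = (\<lambda>j l. iter_int M j (\<lambda>us. iter_int M l (A us)))"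
  have coeff: "ennreal (1 / fact k) * of_nat (k choose j) = ennreal (1 / fact j) * ennreal (1 / fact (k - j))"
    if "j \<le> k" for j k
    using that by (simp add: ennreal_of_nat_eq_real_of_nat binomial_fact flip: ennreal_mult)
  have "poisson_int M (\<lambda>ys. split_sum ys A)
      = (\<Sum>k. \<Sum>j\<le>k. (ennreal (1 / fact k) * of_nat (k choose j)) * c j (k - j))"
    by (simp add: poisson_int_def iter_int_split_sum c_def sum_distrib_left mult.assoc)
  also have "\<dots> = (\<Sum>k. \<Sum>j\<le>k. ennreal (1 / fact j) * (ennreal (1 / fact (k - j)) * c j (k - j)))"
    by (intro suminf_cong sum.cong refl) (simp add: coeff mult.assoc)
  also have "\<dots> = (\<Sum>j. \<Sum>l. ennreal (1 / fact j) * (ennreal (1 / fact l) * c j l))"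
    by (rule suminf_ennreal_Cauchy)
  also have "\<dots> = poisson_int M (\<lambda>us. poisson_int M (A us))"
    by (simp add: poisson_int_def c_def iter_int_suminf iter_int_cmult)
  finally show ?thesis .
qed

text \<open>The Mecke formula for one point: the \<open>Suc k\<close> choices of that point lower
  \<open>1 / fact (Suc k)\<close> to \<open>1 / fact k\<close>.\<close>

lemma poisson_int_pick_sum:
  assumes [measurable]: "(\<lambda>(u, us). B u us) \<in> borel_measurable (borel \<Otimes>\<^sub>M list_borel)"
  shows "poisson_int M (\<lambda>ys. pick_sum ys B) = (\<integral>\<^sup>+ u. poisson_int M (B u) \<partial>M)"
proof -
  \<comment> \<open>The empty configuration offers no point to pick, so its term is zero and the
    index can be shifted.\<close>
  have "poisson_int M (\<lambda>ys. pick_sum ys B) = (\<Sum>k. ennreal (1 / fact (Suc k)) * iter_int M (Suc k) (\<lambda>ys. pick_sum ys B))"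
    unfolding poisson_int_def by (subst suminf_offset[of _ 1]) (auto simp del: fact_Suc iter_int.simps simp: iter_int.simps(1))
  also have "\<dots> = (\<Sum>k. \<integral>\<^sup>+ u. ennreal (1 / fact k) * iter_int M k (B u) \<partial>M)"
  proof (rule suminf_cong)
    fix k
    have "ennreal (1 / fact (Suc k)) * of_nat (Suc k) = ennreal (1 / fact k)"
      by (simp add: ennreal_of_nat_eq_real_of_nat flip: ennreal_mult del: of_nat_Suc)
    then show "ennreal (1 / fact (Suc k)) * iter_int M (Suc k) (\<lambda>ys. pick_sum ys B)
        = (\<integral>\<^sup>+ u. ennreal (1 / fact k) * iter_int M k (B u) \<partial>M)"
      unfolding iter_int_pick_sum[OF assms] by (simp add: nn_integral_cmult flip: mult.assoc)
  qed
  also have "\<dots> = (\<integral>\<^sup>+ u. poisson_int M (B u) \<partial>M)"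
    unfolding poisson_int_def by (rule nn_integral_suminf[symmetric]) measurable
  finally show ?thesis .
qed

text \<open>The multivariate Mecke formula, obtained by picking one point after the other.\<close>

lemma poisson_int_fact_sum:
  assumes "(\<lambda>(us, vs). A us vs) \<in> borel_measurable (list_borel \<Otimes>\<^sub>M list_borel)"
  shows "poisson_int M (\<lambda>ys. fact_sum n ys A) = iter_int M n (\<lambda>us. poisson_int M (A us))"
  using assms
proof (induction n arbitrary: A)
  case (Suc n)
  note [measurable] = Suc.prems
  have "poisson_int M (\<lambda>ys. fact_sum (Suc n) ys A)
      = (\<integral>\<^sup>+ u. poisson_int M (\<lambda>us. fact_sum n us (\<lambda>ws. A (u # ws))) \<partial>M)"
    unfolding fact_sum.simps by (rule poisson_int_pick_sum) measurable
  also have "\<dots> = iter_int M (Suc n) (\<lambda>us. poisson_int M (A us))"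
    by (subst Suc.IH) (auto simp: iter_int_Cons' simp del: iter_int.simps)
  finally show ?case .
qed simp

end

section \<open>Convergence and correlation functions\<close>

lemma poisson_int_Nil: "poisson_int M (\<lambda>ys. if ys = [] then c else 0) = c"
proof -
  have "iter_int M k (\<lambda>ys. if ys = [] then c else 0) = (if k = 0 then c else 0)" for k
    by (cases k) (simp_all add: iter_int_const)
  then have "poisson_int M (\<lambda>ys. if ys = [] then c else 0) = (\<Sum>k. if k = 0 then c else 0)"
    unfolding poisson_int_def by (intro suminf_cong) auto
  also have "\<dots> = (\<Sum>k\<in>{0::nat}. if k = 0 then c else 0)"
    by (rule suminf_finite) auto
  finally show ?thesis by simp
qed

lemma poisson_int_zero: "poisson_int M (\<lambda>_. 0) = 0"
  using poisson_int_Nil[of M 0] by simp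

lemma poisson_int_head:
  "poisson_int M g = g [] + (\<Sum>k. ennreal (1 / fact (Suc k)) * iter_int M (Suc k) g)"
  unfolding poisson_int_def by (subst suminf_offset[of _ 1]) (auto simp del: fact_Suc iter_int.simps simp: iter_int.simps(1) add.commute)

lemma poisson_int_ge_Nil: "g [] \<le> poisson_int M g"
  unfolding poisson_int_head by simp

lemma poisson_int_finite:
  assumes "finite_measure M" "\<And>ys. g ys \<le> 1"
  shows "poisson_int M g < \<top>"
proof -
  interpret finite_measure M by fact
  have "poisson_int M g \<le> poisson_int M (\<lambda>_. 1)"
    using assms(2) by (rule poisson_int_mono)
  also have "\<dots> = (\<Sum>k. ennreal (measure M (space M) ^ k / fact k))"
    unfolding poisson_int_def iter_int_const
    by (simp add: emeasure_eq_measure ennreal_power divide_inverse mult.commute flip: ennreal_mult)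
  also have "\<dots> = ennreal (exp (measure M (space M)))"
    using exp_converges[of "measure M (space M)"]
    by (intro suminf_ennreal_eq) (auto simp: divide_inverse mult.commute)
  finally show ?thesis by (simp add: order_le_less_trans)
qed

text \<open>Drops the factors 1 + f \<le> 1 linking \<open>us\<close> to \<open>xs\<close>. The
  weight within \<open>us\<close> survives, to match the one in the hypothesis on
  \<open>a\<close>.\<close>

lemma boltzmann_append_le:
  assumes f: "\<And>x y. 0 \<le> 1 + f x y" "\<And>x y. f x y \<le> 0"
  shows "boltzmann f (us @ xs) \<le> boltzmann f us * boltzmann f xs"
proof (induction us)
  case (Cons u us)
  have nn: "0 \<le> (\<Prod>y\<leftarrow>ys. 1 + f u y) \<and> (\<Prod>y\<leftarrow>ys. 1 + f u y) \<le> 1" for ys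
    by (rule prod_list_mem01) (simp add: f)
  have "boltzmann f ((u # us) @ xs) = (\<Prod>y\<leftarrow>us. 1 + f u y) * (\<Prod>y\<leftarrow>xs. 1 + f u y) * boltzmann f (us @ xs)"
    by simp
  also have "\<dots> \<le> (\<Prod>y\<leftarrow>us. 1 + f u y) * 1 * (boltzmann f us * boltzmann f xs)"
    using nn boltzmann_mem01[of f, OF f] by (intro mult_mono Cons.IH mult_nonneg_nonneg) auto
  finally show ?case by simp
qed simp

section \<open>The bound on the \<psi> series and its quotient formula\<close>

locale repulsive_gas = borel_sigma_finite M for M :: "'a::topological_space measure" +
  fixes f :: "'a \<Rightarrow> 'a \<Rightarrow> real"
  assumes f_measurable [measurable]: "case_prod f \<in> borel_measurable (borel \<Otimes>\<^sub>M borel)"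
    and f_sym: "f x y = f y x"
    and f_ge: "0 \<le> 1 + f x y"
    and f_le: "f x y \<le> 0"
begin

lemmas boltz01 = boltzmann_mem01[of f, OF f_ge f_le]
lemmas rooted_meas [measurable (raw)] = borel_measurable_rooted[OF f_measurable]
lemmas boltzmann_meas [measurable (raw)] = borel_measurable_boltzmann[OF f_measurable]

text \<open>Truncating by the total number of points makes the recursion decrease \<open>N\<close>.\<close>
lemma poisson_int_rooted_trunc_le:
  fixes a :: "'a \<Rightarrow> real"
  assumes [measurable]: "a \<in> borel_measurable borel"
    and G: "AE y in M. y \<in> G"
    and KP: "\<And>x. x \<in> G \<Longrightarrow> poisson_int M (\<lambda>ys. ennreal ((\<Prod>y\<leftarrow>ys. \<bar>f x y\<bar>) * boltzmann f ys * (\<Prod>y\<leftarrow>ys. exp (a y))))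
      \<le> ennreal (exp (a x))"
    and "set xs \<subseteq> G"
  shows "poisson_int M (\<lambda>ys. if length xs + length ys \<le> N then ennreal \<bar>rooted f xs ys\<bar> else 0)
    \<le> ennreal (boltzmann f xs * (\<Prod>x\<leftarrow>xs. exp (a x)))"
  using assms(4)
proof (induction N arbitrary: xs)
  case 0
  show ?case
  proof (cases xs)
    case Nil
    then have "(\<lambda>ys. if length xs + length ys \<le> 0 then ennreal \<bar>rooted f xs ys\<bar> else 0) = (\<lambda>ys. if ys = [] then 1 else 0)"
      by auto
    then show ?thesis using Nil by (simp only: poisson_int_Nil) simp
  qed (simp add: poisson_int_zero)
next
  case (Suc N)
  show ?case
  proof (cases xs)
    case Nil
    then have "(\<lambda>ys. if length xs + length ys \<le> Suc N then ennreal \<bar>rooted f xs ys\<bar> else 0) = (\<lambda>ys. if ys = [] then 1 else 0)"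
      by auto
    then show ?thesis using Nil by (simp only: poisson_int_Nil) simp
  next
    case (Cons x xs')
    define c where "c = (\<Prod>y\<leftarrow>xs'. 1 + f x y)"
    define E where "E = (\<lambda>xs. \<Prod>x\<leftarrow>xs. exp (a x))"
    define T where "T = (\<lambda>xs ys. if length xs + length ys \<le> N then ennreal \<bar>rooted f xs ys\<bar> else 0)"
    have [measurable]: "length \<in> borel_measurable (list_borel :: 'a list measure)"
      by (rule measurable_compose[OF measurable_length_list_borel, of "\<lambda>n. n"]) simp
    have [measurable]: "(\<lambda>(us, vs). T (us @ xs') vs) \<in> borel_measurable (list_borel \<Otimes>\<^sub>M list_borel)"
      unfolding T_def by measurable
    have [measurable]: "E \<in> borel_measurable list_borel" unfolding E_def by measurable
    have c: "0 \<le> c" unfolding c_def by (rule prod_list_nonneg) (auto simp: f_ge)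
    have pf: "0 \<le> (\<Prod>u\<leftarrow>us. \<bar>f x u\<bar>)" for us by (rule prod_list_nonneg) auto
    have E: "0 \<le> E us" for us unfolding E_def by (rule prod_list_nonneg) auto
    \<comment> \<open>Every split has one point fewer in total, whatever \<open>us\<close> is, so
      truncation at \<open>Suc N\<close> becomes truncation at \<open>N\<close> in each
      term.\<close>
    have step: "(if length xs + length ys \<le> Suc N then ennreal \<bar>rooted f xs ys\<bar> else 0)
        = ennreal c * split_sum ys (\<lambda>us vs. ennreal (\<Prod>u\<leftarrow>us. \<bar>f x u\<bar>) * T (us @ xs') vs)" for ys
    proof -
      have "split_sum ys (\<lambda>us vs. ennreal (\<Prod>u\<leftarrow>us. \<bar>f x u\<bar>) * T (us @ xs') vs)
          = split_sum ys (\<lambda>us vs. if length xs + length ys \<le> Suc N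
              then ennreal ((\<Prod>u\<leftarrow>us. \<bar>f x u\<bar>) * \<bar>rooted f (us @ xs') vs\<bar>) else 0)"
        by (rule split_sum_cong) (auto simp: T_def Cons ennreal_mult pf)
      also have "\<dots> = (if length xs + length ys \<le> Suc N then
          split_sum ys (\<lambda>us vs. ennreal ((\<Prod>u\<leftarrow>us. \<bar>f x u\<bar>) * \<bar>rooted f (us @ xs') vs\<bar>)) else 0)"
        using split_sum_mult_left[of ys "0::ennreal" "\<lambda>_ _. 0"] by simp
      also have "split_sum ys (\<lambda>us vs. ennreal ((\<Prod>u\<leftarrow>us. \<bar>f x u\<bar>) * \<bar>rooted f (us @ xs') vs\<bar>))
          = ennreal (split_sum ys (\<lambda>us vs. (\<Prod>u\<leftarrow>us. \<bar>f x u\<bar>) * \<bar>rooted f (us @ xs') vs\<bar>))"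
        by (rule split_sum_ennreal) (simp add: pf)
      finally have eq: "split_sum ys (\<lambda>us vs. ennreal (\<Prod>u\<leftarrow>us. \<bar>f x u\<bar>) * T (us @ xs') vs)
          = (if length xs + length ys \<le> Suc N then ennreal (split_sum ys
              (\<lambda>us vs. (\<Prod>u\<leftarrow>us. \<bar>f x u\<bar>) * \<bar>rooted f (us @ xs') vs\<bar>)) else 0)" .
      show ?thesis
        unfolding eq unfolding Cons abs_rooted_Cons[of f, OF f_ge f_le] c_def[symmetric] ennreal_mult'[OF c]
        by simp
    qed
    have "poisson_int M (\<lambda>ys. if length xs + length ys \<le> Suc N then ennreal \<bar>rooted f xs ys\<bar> else 0)
        = ennreal c * poisson_int M (\<lambda>us. ennreal (\<Prod>u\<leftarrow>us. \<bar>f x u\<bar>) * poisson_int M (T (us @ xs')))"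
      unfolding step by (subst poisson_int_cmult, measurable) (subst poisson_int_split_sum, measurable, subst poisson_int_cmult, auto)
    \<comment> \<open>The points of \<open>us\<close> become roots, and the induction hypothesis
      covers only roots in \<open>G\<close>; configurations with a point outside \<open>G\<close> do
      not affect the integral.\<close>
    also have "poisson_int M (\<lambda>us. ennreal (\<Prod>u\<leftarrow>us. \<bar>f x u\<bar>) * poisson_int M (T (us @ xs')))
        \<le> poisson_int M (\<lambda>us. ennreal (boltzmann f xs' * E xs') * ennreal ((\<Prod>u\<leftarrow>us. \<bar>f x u\<bar>) * boltzmann f us * E us))"
    proof (rule poisson_int_mono_AE[OF G])
      fix us assume us: "set us \<subseteq> G"
      have "poisson_int M (T (us @ xs')) \<le> ennreal (boltzmann f (us @ xs') * E (us @ xs'))"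
        unfolding T_def E_def by (rule Suc.IH) (use us Suc.prems Cons in auto)
      \<comment> \<open>Decoupling \<open>us\<close> from the other roots leaves the integrand of
        \<open>KP\<close> at \<open>x\<close>, up to a factor free of \<open>us\<close>.\<close>
      also have "\<dots> \<le> ennreal ((boltzmann f us * boltzmann f xs') * (E us * E xs'))"
      proof -
        have "E (us @ xs') = E us * E xs'" by (simp add: E_def)
        moreover have "boltzmann f (us @ xs') * E (us @ xs') \<le> (boltzmann f us * boltzmann f xs') * E (us @ xs')"
          by (intro mult_right_mono boltzmann_append_le f_ge f_le E)
        ultimately show ?thesis by (simp add: ennreal_leI)
      qed
      finally have "ennreal (\<Prod>u\<leftarrow>us. \<bar>f x u\<bar>) * poisson_int M (T (us @ xs'))
          \<le> ennreal (\<Prod>u\<leftarrow>us. \<bar>f x u\<bar>) * ennreal ((boltzmann f us * boltzmann f xs') * (E us * E xs'))"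
        by (rule mult_left_mono) simp
      also have "\<dots> = ennreal (boltzmann f xs' * E xs') * ennreal ((\<Prod>u\<leftarrow>us. \<bar>f x u\<bar>) * boltzmann f us * E us)"
        using pf E boltz01 by (simp add: mult_ac flip: ennreal_mult)
      finally show "ennreal (\<Prod>u\<leftarrow>us. \<bar>f x u\<bar>) * poisson_int M (T (us @ xs'))
          \<le> ennreal (boltzmann f xs' * E xs') * ennreal ((\<Prod>u\<leftarrow>us. \<bar>f x u\<bar>) * boltzmann f us * E us)" .
    qed
    also have "\<dots> = ennreal (boltzmann f xs' * E xs') * poisson_int M (\<lambda>us. ennreal ((\<Prod>u\<leftarrow>us. \<bar>f x u\<bar>) * boltzmann f us * E us))"
      by (rule poisson_int_cmult) measurable
    \<comment> \<open>The integral over \<open>us\<close> yields the factor \<open>exp (a x)\<close>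
      of the deleted root, and \<open>c\<close> completes the weight of \<open>xs'\<close> to that
      of \<open>xs\<close>.\<close>
    also have "\<dots> \<le> ennreal (boltzmann f xs' * E xs') * ennreal (exp (a x))"
      using KP[of x] Suc.prems Cons by (intro mult_left_mono) (auto simp: E_def)
    finally have "poisson_int M (\<lambda>ys. if length xs + length ys \<le> Suc N then ennreal \<bar>rooted f xs ys\<bar> else 0)
        \<le> ennreal c * (ennreal (boltzmann f xs' * E xs') * ennreal (exp (a x)))"
      by (simp add: mult_left_mono)
    also have "\<dots> = ennreal (boltzmann f xs * E xs)"
      using c boltz01 E by (simp add: Cons c_def E_def mult_ac flip: ennreal_mult)
    finally show ?thesis by (simp add: E_def)
  qed
qed

text \<open>The partial sum over \<open>k < n\<close> involves fewer than \<open>n\<close>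
  non-roots, so truncation at \<open>length xs + n\<close> leaves it unchanged, and the truncated
  bound does not depend on \<open>n\<close>.\<close>

lemma poisson_int_rooted_le:
  fixes a :: "'a \<Rightarrow> real"
  assumes "a \<in> borel_measurable borel" "AE y in M. y \<in> G"
    and "\<And>x. x \<in> G \<Longrightarrow> poisson_int M (\<lambda>ys. ennreal ((\<Prod>y\<leftarrow>ys. \<bar>f x y\<bar>) * boltzmann f ys * (\<Prod>y\<leftarrow>ys. exp (a y))))
      \<le> ennreal (exp (a x))"
    and "set xs \<subseteq> G"
  shows "poisson_int M (\<lambda>ys. ennreal \<bar>rooted f xs ys\<bar>) \<le> ennreal (boltzmann f xs * (\<Prod>x\<leftarrow>xs. exp (a x)))"
  unfolding poisson_int_def
proof (rule suminf_le_const[OF summableI])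
  fix n
  let ?g = "\<lambda>ys. if length xs + length ys \<le> length xs + n then ennreal \<bar>rooted f xs ys\<bar> else 0"
  have "(\<Sum>k<n. ennreal (1 / fact k) * iter_int M k (\<lambda>ys. ennreal \<bar>rooted f xs ys\<bar>))
      = (\<Sum>k<n. ennreal (1 / fact k) * iter_int M k ?g)"
    by (intro sum.cong refl arg_cong2[where f = "(*)"] iter_int_cong) auto
  also have "\<dots> \<le> poisson_int M ?g"
    unfolding poisson_int_def by (rule sum_le_suminf) auto
  also have "\<dots> \<le> ennreal (boltzmann f xs * (\<Prod>x\<leftarrow>xs. exp (a x)))"
    by (rule poisson_int_rooted_trunc_le[OF assms])
  finally show "(\<Sum>k<n. ennreal (1 / fact k) * iter_int M k (\<lambda>ys. ennreal \<bar>rooted f xs ys\<bar>))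
    \<le> ennreal (boltzmann f xs * (\<Prod>x\<leftarrow>xs. exp (a x)))" .
qed

text \<open>The integrated form of \<open>boltzmann_split\<close>. Moving the negative part of
  \<open>rooted\<close> to the left avoids subtraction in \<open>ennreal\<close>, so the identity
  holds even where the integrals are infinite.\<close>

lemma poisson_int_boltzmann_split:
  "poisson_int M (\<lambda>ys. ennreal (boltzmann f (xs @ ys)))
     + poisson_int M (\<lambda>ys. ennreal (- rooted f xs ys)) * poisson_int M (\<lambda>ys. ennreal (boltzmann f ys))
   = poisson_int M (\<lambda>ys. ennreal (rooted f xs ys)) * poisson_int M (\<lambda>ys. ennreal (boltzmann f ys))"
proof -
  \<comment> \<open>The value \<open>s = 1\<close> gives the positive and \<open>s = -1\<close> the
    negative part, since \<open>ennreal\<close> sends negative numbers to 0.\<close>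
  have split: "poisson_int M (\<lambda>ys. split_sum ys (\<lambda>us vs. ennreal (s * rooted f xs us) * ennreal (boltzmann f vs)))
    = poisson_int M (\<lambda>ys. ennreal (s * rooted f xs ys)) * poisson_int M (\<lambda>ys. ennreal (boltzmann f ys))" for s
    by (subst poisson_int_split_sum, measurable)
       (subst poisson_int_cmult, measurable, subst mult.commute, subst poisson_int_cmult, auto simp: mult.commute)
  have part: "split_sum ys (\<lambda>us vs. ennreal (s * rooted f xs us) * ennreal (boltzmann f vs))
    = ennreal (split_sum ys (\<lambda>us vs. max 0 (s * rooted f xs us) * boltzmann f vs))" for s ys
  proof -
    have "split_sum ys (\<lambda>us vs. ennreal (s * rooted f xs us) * ennreal (boltzmann f vs))
       = split_sum ys (\<lambda>us vs. ennreal (max 0 (s * rooted f xs us) * boltzmann f vs))"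
      using boltz01 by (intro split_sum_cong refl) (simp add: ennreal_mult max_def ennreal_neg)
    also have "\<dots> = ennreal (split_sum ys (\<lambda>us vs. max 0 (s * rooted f xs us) * boltzmann f vs))"
      using boltz01 by (intro split_sum_ennreal mult_nonneg_nonneg) auto
    finally show ?thesis .
  qed
  have nn: "0 \<le> split_sum ys (\<lambda>us vs. max 0 (s * rooted f xs us) * boltzmann f vs)" for s ys
    using boltz01 by (intro split_sum_nonneg mult_nonneg_nonneg) auto
  have pt: "ennreal (boltzmann f (xs @ ys)) + split_sum ys (\<lambda>us vs. ennreal ((-1) * rooted f xs us) * ennreal (boltzmann f vs))
    = split_sum ys (\<lambda>us vs. ennreal (1 * rooted f xs us) * ennreal (boltzmann f vs))" for ys
  proof -
    have eq: "boltzmann f (xs @ ys) + split_sum ys (\<lambda>us vs. max 0 ((-1) * rooted f xs us) * boltzmann f vs)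
        = split_sum ys (\<lambda>us vs. max 0 (1 * rooted f xs us) * boltzmann f vs)"
      unfolding boltzmann_split[of f, OF f_sym] split_sum_add[symmetric]
      by (intro split_sum_cong refl) (auto simp: max_def algebra_simps)
    show ?thesis
      unfolding part ennreal_plus[OF conjunct1[OF boltz01] nn, symmetric] eq ..
  qed
  have "poisson_int M (\<lambda>ys. ennreal (boltzmann f (xs @ ys)) + split_sum ys (\<lambda>us vs. ennreal ((-1) * rooted f xs us) * ennreal (boltzmann f vs)))
      = poisson_int M (\<lambda>ys. split_sum ys (\<lambda>us vs. ennreal (1 * rooted f xs us) * ennreal (boltzmann f vs)))"
    unfolding pt ..
  then show ?thesis
    unfolding split by (subst (asm) poisson_int_add) (auto simp: split[of "-1", simplified])
qed

text \<open>Finiteness of the integral of the absolute value makes both parts summable, so they may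
  be subtracted term by term; this turns \<open>ennreal\<close> values into a real series of Bochner
  integrals.\<close>

lemma poisson_int_real:
  assumes g: "g \<in> borel_measurable list_borel" and fin: "poisson_int M (\<lambda>ys. ennreal \<bar>g ys\<bar>) < \<top>"
  shows "enn2real (poisson_int M (\<lambda>ys. ennreal (g ys))) - enn2real (poisson_int M (\<lambda>ys. ennreal (- g ys)))
    = g [] + (\<Sum>k. 1 / fact (Suc k) * (\<integral>y. g (map y [0..<Suc k]) \<partial>PiM {..<Suc k} (\<lambda>_. M)))"
proof -
  note [measurable] = g
  \<comment> \<open>For \<open>s = 1\<close> and \<open>s = -1\<close> these are the integrals of
    the positive and negative part over \<open>k\<close> points.\<close>
  define p where "p = (\<lambda>s k. enn2real (iter_int M k (\<lambda>ys. ennreal (s * g ys))))"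
  have fink: "iter_int M k (\<lambda>ys. ennreal \<bar>g ys\<bar>) < \<top>" for k
  proof -
    have "ennreal (1 / fact k) * iter_int M k (\<lambda>ys. ennreal \<bar>g ys\<bar>)
        = (\<Sum>i\<in>{k}. ennreal (1 / fact i) * iter_int M i (\<lambda>ys. ennreal \<bar>g ys\<bar>))" by simp
    also have "\<dots> \<le> poisson_int M (\<lambda>ys. ennreal \<bar>g ys\<bar>)"
      unfolding poisson_int_def by (rule sum_le_suminf) auto
    finally have "ennreal (1 / fact k) * iter_int M k (\<lambda>ys. ennreal \<bar>g ys\<bar>) < \<top>"
      using fin by (rule order_le_less_trans)
    then show ?thesis by (auto simp: ennreal_mult_less_top)
  qed
  have finp: "iter_int M k (\<lambda>ys. ennreal (s * g ys)) < \<top>" if "\<bar>s\<bar> = 1" for s k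
    by (rule order_le_less_trans[OF iter_int_mono fink])
       (use that in \<open>auto intro!: ennreal_leI simp: abs_if split: if_splits\<close>)
  have sums: "(\<lambda>k. 1 / fact k * p s k) sums enn2real (poisson_int M (\<lambda>ys. ennreal (s * g ys)))"
    if s: "\<bar>s\<bar> = 1" for s
  proof -
    have p: "iter_int M k (\<lambda>ys. ennreal (s * g ys)) = ennreal (p s k)" for k
      using finp[OF s, of k] by (simp add: p_def)
    have eq: "poisson_int M (\<lambda>ys. ennreal (s * g ys)) = (\<Sum>k. ennreal (1 / fact k * p s k))"
      unfolding poisson_int_def p by (simp add: ennreal_mult' del: times_divide_eq_left)
    have "poisson_int M (\<lambda>ys. ennreal (s * g ys)) \<le> poisson_int M (\<lambda>ys. ennreal \<bar>g ys\<bar>)"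
      by (rule poisson_int_mono) (use s in \<open>auto intro!: ennreal_leI simp: abs_if split: if_splits\<close>)
    with fin have top: "(\<Sum>k. ennreal (1 / fact k * p s k)) \<noteq> \<top>" unfolding eq by auto
    have nn: "0 \<le> 1 / fact k * p s k" for k by (simp add: p_def)
    have "summable (\<lambda>k. 1 / fact k * p s k)"
      by (rule summable_suminf_not_top[OF nn top])
    moreover have "enn2real (poisson_int M (\<lambda>ys. ennreal (s * g ys))) = (\<Sum>k. 1 / fact k * p s k)"
      unfolding eq using suminf_ennreal[OF nn top] \<open>summable _\<close> nn by (simp add: suminf_nonneg)
    ultimately show ?thesis by (simp add: summable_sums)
  qed
  have int: "(\<integral>y. g (map y [0..<k]) \<partial>PiM {..<k} (\<lambda>_. M)) = p 1 k - p (-1) k" for k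
  proof -
    have [measurable]: "(\<lambda>x. map x [0..<k]) \<in> measurable (PiM {..<k} (\<lambda>_. M)) list_borel"
      by (rule measurable_map_list) auto
    have "integrable (PiM {..<k} (\<lambda>_. M)) (\<lambda>y. g (map y [0..<k]))"
      using fink[of k] by (subst (asm) iter_int_eq_PiM) (auto simp: integrable_iff_bounded)
    then show ?thesis
      by (simp add: real_lebesgue_integral_def p_def iter_int_eq_PiM)
  qed
  have "(\<lambda>k. 1 / fact k * (p 1 k - p (-1) k))
      sums (enn2real (poisson_int M (\<lambda>ys. ennreal (g ys))) - enn2real (poisson_int M (\<lambda>ys. ennreal (- g ys))))"
    using sums_diff[OF sums[of 1] sums[of "-1"]]
    by (simp only: right_diff_distrib mult_1_left mult_minus1 abs_one abs_minus_cancel)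
  \<comment> \<open>The term \<open>k = 0\<close> is the value at the empty list and is split
    off.\<close>
  from sums_split_initial_segment[OF this, of 1]
  have "(\<lambda>k. 1 / fact (Suc k) * (\<integral>y. g (map y [0..<Suc k]) \<partial>PiM {..<Suc k} (\<lambda>_. M)))
      sums (enn2real (poisson_int M (\<lambda>ys. ennreal (g ys))) - enn2real (poisson_int M (\<lambda>ys. ennreal (- g ys))) - (p 1 0 - p (-1) 0))"
    unfolding int by (simp del: fact_Suc)
  moreover have "p 1 0 - p (-1) 0 = g []"
    by (cases "0 \<le> g []") (simp_all add: p_def ennreal_neg)
  ultimately show ?thesis by (simp add: sums_iff)
qed

lemma boltzmann_ratio:
  assumes Z: "poisson_int M (\<lambda>ys. ennreal (boltzmann f ys)) < \<top>"
    and R: "poisson_int M (\<lambda>ys. ennreal \<bar>rooted f xs ys\<bar>) < \<top>"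
  shows "poisson_int M (\<lambda>ys. ennreal (boltzmann f (xs @ ys))) / poisson_int M (\<lambda>ys. ennreal (boltzmann f ys)) < \<top>"
    and "enn2real (poisson_int M (\<lambda>ys. ennreal (boltzmann f (xs @ ys))) / poisson_int M (\<lambda>ys. ennreal (boltzmann f ys)))
      = boltzmann f xs + (\<Sum>k. 1 / fact (Suc k) * (\<integral>y. rooted f xs (map y [0..<Suc k]) \<partial>PiM {..<Suc k} (\<lambda>_. M)))"
proof -
  let ?E = "\<lambda>s. poisson_int M (\<lambda>ys. ennreal (s * rooted f xs ys))"
  obtain Z' where Z': "poisson_int M (\<lambda>ys. ennreal (boltzmann f ys)) = ennreal Z'" "0 \<le> Z'"
    using Z by (cases "poisson_int M (\<lambda>ys. ennreal (boltzmann f ys))") auto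
  \<comment> \<open>The empty configuration has weight 1, so the partition function is at least 1
    and can be divided out.\<close>
  have "1 \<le> ennreal Z'" using poisson_int_ge_Nil[of "\<lambda>ys. ennreal (boltzmann f ys)" M] Z' by simp
  then have "1 \<le> Z'" using Z' by (simp add: ennreal_1[symmetric] del: ennreal_1)
  have fin: "?E s < \<top>" if s: "\<bar>s\<bar> = 1" for s
    by (rule order_le_less_trans[OF poisson_int_mono R])
       (use s in \<open>auto intro!: ennreal_leI simp: abs_if split: if_splits\<close>)
  obtain p q where pq: "?E 1 = ennreal p" "0 \<le> p" "?E (-1) = ennreal q" "0 \<le> q"
    using fin[of 1] fin[of "-1"] by (cases "?E 1"; cases "?E (-1)") auto
  have id: "poisson_int M (\<lambda>ys. ennreal (boltzmann f (xs @ ys))) + ennreal (q * Z') = ennreal (p * Z')"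
    using poisson_int_boltzmann_split[of xs] pq Z' by (simp add: ennreal_mult)
  \<comment> \<open>Finite, being a summand of a finite right-hand side.\<close>
  then obtain w where w: "poisson_int M (\<lambda>ys. ennreal (boltzmann f (xs @ ys))) = ennreal w" "0 \<le> w"
    by (cases "poisson_int M (\<lambda>ys. ennreal (boltzmann f (xs @ ys)))") auto
  have "w + q * Z' = p * Z'" using id w pq Z' by (simp flip: ennreal_plus)
  then have wZ: "w / Z' = p - q" using \<open>1 \<le> Z'\<close> by (simp add: field_simps)
  have ratio: "poisson_int M (\<lambda>ys. ennreal (boltzmann f (xs @ ys))) / poisson_int M (\<lambda>ys. ennreal (boltzmann f ys)) = ennreal (w / Z')"
    using w Z' \<open>1 \<le> Z'\<close> by (simp add: divide_ennreal)
  then show "poisson_int M (\<lambda>ys. ennreal (boltzmann f (xs @ ys))) / poisson_int M (\<lambda>ys. ennreal (boltzmann f ys)) < \<top>"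
    by simp
  have "p - q = rooted f xs [] + (\<Sum>k. 1 / fact (Suc k) * (\<integral>y. rooted f xs (map y [0..<Suc k]) \<partial>PiM {..<Suc k} (\<lambda>_. M)))"
    using poisson_int_real[of "rooted f xs", OF _ R] pq by simp
  moreover have "enn2real (ennreal (w / Z')) = p - q"
    using w Z' by (subst enn2real_ennreal) (auto simp: wZ[symmetric])
  ultimately show "enn2real (poisson_int M (\<lambda>ys. ennreal (boltzmann f (xs @ ys))) / poisson_int M (\<lambda>ys. ennreal (boltzmann f ys)))
      = boltzmann f xs + (\<Sum>k. 1 / fact (Suc k) * (\<integral>y. rooted f xs (map y [0..<Suc k]) \<partial>PiM {..<Suc k} (\<lambda>_. M)))"
    by (simp only: ratio rooted_Nil2)
qed

end

section \<open>Densities, null sets and uniqueness of the correlation function\<close>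

context borel_sigma_finite begin

lemma iter_int_density:
  fixes h :: "'a \<Rightarrow> real"
  assumes h: "h \<in> borel_measurable borel" "\<And>x. 0 \<le> h x" and "g \<in> borel_measurable list_borel"
    and D: "borel_sigma_finite (density M h)"
  shows "iter_int (density M h) k g = iter_int M k (\<lambda>ys. ennreal (\<Prod>y\<leftarrow>ys. h y) * g ys)"
  using assms(3)
proof (induction k arbitrary: g)
  case (Suc k)
  interpret D: borel_sigma_finite "density M h" by fact
  note [measurable] = Suc.prems h(1)
  have nn: "0 \<le> (\<Prod>y\<leftarrow>ys. h y)" for ys by (rule prod_list_nonneg) (auto simp: h)
  have "iter_int (density M h) (Suc k) g = iter_int M k (\<lambda>ys. ennreal (\<Prod>y\<leftarrow>ys. h y) * (\<integral>\<^sup>+ y. g (ys @ [y]) \<partial>density M h))"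
    unfolding iter_int.simps by (rule Suc.IH) measurable
  also have "\<dots> = iter_int M (Suc k) (\<lambda>ys. ennreal (\<Prod>y\<leftarrow>ys. h y) * g ys)"
    unfolding iter_int.simps
    by (intro iter_int_cong) (auto simp: nn_integral_density nn ennreal_mult h mult.assoc simp flip: nn_integral_cmult)
  finally show ?case .
qed simp

text \<open>Configurations whose \<open>i\<close>-th point is exceptional lie in a box with one side
  of measure zero. Other sides may be infinite, but the product in \<open>ennreal\<close> is still
  0.\<close>

lemma AE_PiM_all:
  fixes n :: nat
  assumes "AE x in M. P x"
  shows "AE x in PiM {..<n} (\<lambda>_. M). \<forall>i<n. P (x i)"
proof -
  interpret P: product_sigma_finite "\<lambda>_::nat. M" ..
  from AE_E[OF assms] obtain N where N: "{x \<in> space M. \<not> P x} \<subseteq> N" "emeasure M N = 0" "N \<in> sets M" .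
  have "AE x in PiM {..<n} (\<lambda>_. M). P (x i)" if "i < n" for i
  proof (rule AE_I)
    let ?B = "PiE {..<n} (\<lambda>j. if j = i then N else UNIV)"
    show "{x \<in> space (PiM {..<n} (\<lambda>_. M)). \<not> P (x i)} \<subseteq> ?B"
      using N(1) by (auto simp: space_PiM PiE_def Pi_def)
    have "emeasure (PiM {..<n} (\<lambda>_. M)) ?B = (\<Prod>j<n. emeasure M (if j = i then N else UNIV))"
      using N by (subst P.emeasure_PiM) (auto simp: sets_M)
    also have "\<dots> = 0" using that N by (auto intro!: prod_zero bexI[of _ i])
    finally show "emeasure (PiM {..<n} (\<lambda>_. M)) ?B = 0" .
    show "?B \<in> sets (PiM {..<n} (\<lambda>_. M))"
      using N by (intro sets_PiM_I_finite) (auto simp: sets_M)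
  qed
  then have "AE x in PiM {..<n} (\<lambda>_. M). \<forall>i\<in>{..<n}. P (x i)"
    by (subst AE_finite_all) auto
  then show ?thesis by (simp add: Ball_def)
qed

text \<open>Lets absolute convergence pass from the activity \<open>z\<close> to its restriction to
  a bounded set.\<close>

lemma poisson_int_density_mono:
  fixes h h' :: "'a \<Rightarrow> real"
  assumes "h \<in> borel_measurable borel" "\<And>x. 0 \<le> h x" "h' \<in> borel_measurable borel" "\<And>x. h x \<le> h' x"
    and "g \<in> borel_measurable list_borel"
    and "borel_sigma_finite (density M h)" "borel_sigma_finite (density M h')"
  shows "poisson_int (density M h) g \<le> poisson_int (density M h') g"
proof -
  have nn: "0 \<le> h' x" for x using assms(2,4) order_trans by blast
  have le: "(\<Prod>y\<leftarrow>ys. h y) \<le> (\<Prod>y\<leftarrow>ys. h' y)" for ys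
    by (induction ys) (auto intro!: mult_mono prod_list_nonneg simp: assms(2,4) nn)
  show ?thesis
    unfolding poisson_int_def iter_int_density[OF assms(1,2,5,6)] iter_int_density[OF assms(3) nn assms(5,7)]
    by (intro suminf_le mult_left_mono iter_int_mono mult_right_mono ennreal_leI le) auto
qed

end

lemma prod_list_map_upt: "(\<Prod>u\<leftarrow>map x [0..<n]. g u) = (\<Prod>j<n. g (x j))"
  by (simp add: prod.distinct_set_conv_list[symmetric] atLeast0LessThan o_def)

lemma borel_sigma_finite_bounded:
  fixes M :: "'a::metric_space measure"
  assumes "sets M = sets borel" "\<And>B. B \<in> sets borel \<Longrightarrow> bounded B \<Longrightarrow> emeasure M B < \<infinity>"
  shows "borel_sigma_finite M"
proof
  \<comment> \<open>Balls around an arbitrary centre; \<open>undefined\<close> merely names some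
    point of the space.\<close>
  let ?A = "range (\<lambda>n. cball (undefined :: 'a) (real n))"
  have "(\<Union>n. cball (undefined :: 'a) (real n)) = UNIV"
    using real_arch_simple by auto
  moreover have "emeasure M B \<noteq> \<infinity>" if "B \<in> ?A" for B
    using that assms(2)[of B] by auto
  ultimately show "\<exists>A. countable A \<and> A \<subseteq> sets M \<and> \<Union> A = space M \<and> (\<forall>a\<in>A. emeasure M a \<noteq> \<infinity>)"
    using sets_eq_imp_space_eq[OF assms(1)] by (intro exI[of _ ?A]) (auto simp: assms(1))
qed fact

lemma psi_app:
  assumes "\<And>x y. v x y = v y x"
  shows "psi v n (n + k) (app n x y) = rooted (mayer v) (map x [0..<n]) (map y [0..<k])"
proof -
  have "map (app n x y) [0..<n] = map x [0..<n]" "map (app n x y) [n..<n + k] = map y [0..<k]"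
    by (auto intro!: nth_equalityI simp: app_def)
  then show ?thesis by (simp only: psi_eq_rooted[of v, OF assms])
qed

lemma (in borel_sigma_finite) borel_measurable_mayer:
  assumes "(\<lambda>p. v (fst p) (snd p)) \<in> borel_measurable (M \<Otimes>\<^sub>M M)"
  shows "case_prod (mayer v) \<in> borel_measurable (borel \<Otimes>\<^sub>M borel)"
proof -
  have [measurable]: "(\<lambda>p. v (fst p) (snd p)) \<in> borel_measurable (borel \<Otimes>\<^sub>M borel)"
    using assms by (simp cong: measurable_cong_sets sets_pair_measure_cong add: sets_M)
  show ?thesis unfolding mayer_def case_prod_beta by measurable
qed

lemma repulsive_gas_mayer:
  assumes "borel_sigma_finite M" "case_prod (mayer v) \<in> borel_measurable (borel \<Otimes>\<^sub>M borel)"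
    and "\<And>x y. v x y = v y x"
  shows "repulsive_gas M (mayer v)"
proof -
  interpret borel_sigma_finite M by fact
  show ?thesis
    by unfold_locales (use assms in \<open>auto simp: mayer_def\<close>)
qed

text \<open>Recasts the hypothesis of the theorem as a Poisson sum over lists, with the activities
  absorbed into the measure and the term of the empty list, equal to 1, added on both sides.\<close>

lemma (in borel_sigma_finite) poisson_int_kp:
  assumes f: "case_prod (mayer v) \<in> borel_measurable (borel \<Otimes>\<^sub>M borel)" and sym: "\<And>x y. v x y = v y x"
    and z: "z \<in> borel_measurable borel" "\<And>x. 0 \<le> z x" and a: "a \<in> borel_measurable borel" "0 \<le> a x"
    and D: "borel_sigma_finite (density M z)"
    and KP: "(\<Sum>k. ennreal (1 / fact (Suc k)) *
          (\<integral>\<^sup>+ y. ennreal ((\<Prod>j<Suc k. \<bar>mayer v x (y j)\<bar>) * weight v (Suc k) y * (\<Prod>j<Suc k. z (y j) * exp (a (y j))))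
             \<partial>PiM {..<Suc k} (\<lambda>_. M))) \<le> ennreal (exp (a x) - 1)"
  shows "poisson_int (density M z) (\<lambda>ys. ennreal ((\<Prod>y\<leftarrow>ys. \<bar>mayer v x y\<bar>) * boltzmann (mayer v) ys * (\<Prod>y\<leftarrow>ys. exp (a y))))
    \<le> ennreal (exp (a x))"
proof -
  interpret repulsive_gas M "mayer v"
    using repulsive_gas_mayer[OF borel_sigma_finite_axioms f sym] .
  note [measurable] = z(1) a(1)
  let ?g = "\<lambda>ys. ennreal ((\<Prod>y\<leftarrow>ys. \<bar>mayer v x y\<bar>) * boltzmann (mayer v) ys * (\<Prod>y\<leftarrow>ys. exp (a y)))"
  have g [measurable]: "?g \<in> borel_measurable list_borel" by measurable
  have nn: "0 \<le> (\<Prod>y\<leftarrow>ys. z y)" for ys by (rule prod_list_nonneg) (auto simp: z)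
  have eq: "iter_int (density M z) k ?g =
      (\<integral>\<^sup>+ y. ennreal ((\<Prod>j<k. \<bar>mayer v x (y j)\<bar>) * weight v k y * (\<Prod>j<k. z (y j) * exp (a (y j)))) \<partial>PiM {..<k} (\<lambda>_. M))" for k
  proof -
    have "iter_int (density M z) k ?g = iter_int M k (\<lambda>ys. ennreal (\<Prod>y\<leftarrow>ys. z y) * ?g ys)"
      by (rule iter_int_density[OF z g D])
    also have "\<dots> = (\<integral>\<^sup>+ y. ennreal (\<Prod>u\<leftarrow>map y [0..<k]. z u) * ?g (map y [0..<k]) \<partial>PiM {..<k} (\<lambda>_. M))"
      by (rule iter_int_eq_PiM) measurable
    also have "\<dots> = (\<integral>\<^sup>+ y. ennreal ((\<Prod>j<k. \<bar>mayer v x (y j)\<bar>) * weight v k y * (\<Prod>j<k. z (y j) * exp (a (y j)))) \<partial>PiM {..<k} (\<lambda>_. M))"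
      using z(2) by (intro nn_integral_cong)
        (simp only: prod_nonneg ennreal_mult'[symmetric] prod_list_map_upt weight_eq_boltzmann[of v, OF sym] prod.distrib mult_ac)
    finally show ?thesis .
  qed
  have "poisson_int (density M z) ?g \<le> 1 + ennreal (exp (a x) - 1)"
    unfolding poisson_int_head eq by (intro add_mono KP) simp
  \<comment> \<open>Since \<open>a x\<close> is nonnegative, so is \<open>exp (a x) - 1\<close>, and
    \<open>ennreal\<close> truncates nothing.\<close>
  also have "\<dots> = ennreal (exp (a x))"
    using a by (simp flip: ennreal_plus ennreal_1)
  finally show ?thesis .
qed

lemma (in borel_sigma_finite) gibbs_expect_factsum:
  assumes f: "case_prod (mayer v) \<in> borel_measurable (borel \<Otimes>\<^sub>M borel)" and sym: "\<And>x y. v x y = v y x"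
    and h: "h \<in> borel_measurable borel" "\<And>x. 0 \<le> h x"
    and D: "borel_sigma_finite (density M h)" and L: "lamzL M z L = density M h"
    and g: "g \<in> borel_measurable (PiM {..<n} (\<lambda>_. M))"
  shows "gibbs_expect M z v L (\<lambda>m x. factsum n m g x) =
    (\<integral>\<^sup>+ x. g x * (ennreal (\<Prod>i<n. h (x i)) *
        (poisson_int (density M h) (\<lambda>ys. ennreal (boltzmann (mayer v) (map x [0..<n] @ ys))) /
         poisson_int (density M h) (\<lambda>ys. ennreal (boltzmann (mayer v) ys)))) \<partial>PiM {..<n} (\<lambda>_. M))"
proof -
  let ?f = "mayer v" and ?D = "density M h"
  interpret D: repulsive_gas ?D ?f by (rule repulsive_gas_mayer[OF D f sym])
  interpret product_sigma_finite "\<lambda>_::nat. M" ..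
  note [measurable] = h(1)
  \<comment> \<open>Transports \<open>g\<close> from extensional functions to lists; on lists of
    length \<open>n\<close>, \<open>pad\<close> agrees with indexing.\<close>
  define g' where "g' = (\<lambda>us. g (\<lambda>i\<in>{..<n}. pad us i))"
  define B where "B = (\<lambda>us. poisson_int ?D (\<lambda>ys. ennreal (boltzmann ?f (us @ ys))))"
  define Z where "Z = poisson_int ?D (\<lambda>ys. ennreal (boltzmann ?f ys))"
  have [measurable]: "g' \<in> borel_measurable list_borel"
    unfolding g'_def
  proof (rule measurable_compose[OF _ g])
    show "(\<lambda>us. \<lambda>i\<in>{..<n}. pad us i) \<in> measurable list_borel (PiM {..<n} (\<lambda>_. M))"
      by (rule measurable_restrict) measurable
  qed
  have [measurable]: "B \<in> borel_measurable list_borel" unfolding B_def by measurable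
  have num: "(\<integral>\<^sup>+ x. factsum n m g x * ennreal (weight v m x) \<partial>PiM {..<m} (\<lambda>_. ?D))
      = iter_int ?D m (\<lambda>ys. fact_sum n ys (\<lambda>us vs. g' us * ennreal (boltzmann ?f (us @ vs))))" for m
  proof -
    have "factsum n m g x * ennreal (weight v m x)
        = fact_sum n (map x [0..<m]) (\<lambda>us vs. g' us * ennreal (boltzmann ?f (us @ vs)))" for x
      unfolding factsum_eq_fact_sum fact_sum_mult_right[symmetric]
    proof (rule fact_sum_cong)
      fix us vs assume us: "length us = n" "mset us + mset vs = mset (map x [0..<m])"
      \<comment> \<open>Picking \<open>us\<close> only permutes the configuration, so the common
        weight can be absorbed into each summand in terms of \<open>us\<close> and
        \<open>vs\<close>.\<close>
      then have "boltzmann ?f (us @ vs) = weight v m x"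
        unfolding weight_eq_boltzmann[of v, OF sym] by (intro boltzmann_perm D.f_sym) simp
      moreover have "(\<lambda>i\<in>{..<n}. us ! i) = (\<lambda>i\<in>{..<n}. pad us i)" using us by (auto simp: pad_def)
      ultimately show "g (\<lambda>i\<in>{..<n}. us ! i) * ennreal (weight v m x) = g' us * ennreal (boltzmann ?f (us @ vs))"
        by (simp add: g'_def)
    qed
    then show ?thesis by (subst D.iter_int_eq_PiM) auto
  qed
  have den: "(\<integral>\<^sup>+ x. ennreal (weight v m x) \<partial>PiM {..<m} (\<lambda>_. ?D)) = iter_int ?D m (\<lambda>ys. ennreal (boltzmann ?f ys))" for m
    unfolding weight_eq_boltzmann[of v, OF sym] by (rule D.iter_int_eq_PiM[symmetric]) measurable
  have "gibbs_expect M z v L (\<lambda>m x. factsum n m g x)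
      = poisson_int ?D (\<lambda>ys. fact_sum n ys (\<lambda>us vs. g' us * ennreal (boltzmann ?f (us @ vs)))) / Z"
    unfolding gibbs_expect_def L num den Z_def poisson_int_def ..
  also have "poisson_int ?D (\<lambda>ys. fact_sum n ys (\<lambda>us vs. g' us * ennreal (boltzmann ?f (us @ vs))))
      = iter_int ?D n (\<lambda>us. g' us * B us)"
    unfolding B_def by (subst D.poisson_int_fact_sum, measurable) (subst D.poisson_int_cmult, auto)
  also have "\<dots> = iter_int M n (\<lambda>us. ennreal (\<Prod>u\<leftarrow>us. h u) * (g' us * B us))"
    by (rule iter_int_density[OF h _ D]) measurable
  also have "\<dots> = (\<integral>\<^sup>+ x. ennreal (\<Prod>u\<leftarrow>map x [0..<n]. h u) * (g' (map x [0..<n]) * B (map x [0..<n])) \<partial>PiM {..<n} (\<lambda>_. M))"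
    by (rule iter_int_eq_PiM) measurable
  also have "\<dots> = (\<integral>\<^sup>+ x. g x * (ennreal (\<Prod>i<n. h (x i)) * B (map x [0..<n])) \<partial>PiM {..<n} (\<lambda>_. M))"
  proof (rule nn_integral_cong)
    fix x assume "x \<in> space (PiM {..<n} (\<lambda>_. M))"
    then have "(\<lambda>i\<in>{..<n}. pad (map x [0..<n]) i) = x"
      by (auto simp: space_PiM PiE_def extensional_def fun_eq_iff pad_def)
    then show "ennreal (\<Prod>u\<leftarrow>map x [0..<n]. h u) * (g' (map x [0..<n]) * B (map x [0..<n]))
        = g x * (ennreal (\<Prod>i<n. h (x i)) * B (map x [0..<n]))"
      unfolding prod_list_map_upt by (simp add: g'_def mult.left_commute)
  qed
  also have "\<dots> / Z = (\<integral>\<^sup>+ x. g x * (ennreal (\<Prod>i<n. h (x i)) * B (map x [0..<n])) / Z \<partial>PiM {..<n} (\<lambda>_. M))"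
  proof (rule nn_integral_divide[symmetric])
    have [measurable]: "(\<lambda>x. map x [0..<n]) \<in> measurable (PiM {..<n} (\<lambda>_. M)) list_borel"
      by (rule measurable_map_list) auto
    note [measurable] = g
    show "(\<lambda>x. g x * (ennreal (\<Prod>i<n. h (x i)) * B (map x [0..<n]))) \<in> borel_measurable (PiM {..<n} (\<lambda>_. M))"
      by measurable
  qed
  finally show ?thesis by (simp add: B_def Z_def ennreal_times_divide)
qed

text \<open>Testing with indicators shows that \<rho> and the explicit formula have the same
  integral over every measurable set; on a \<sigma>-finite space they then agree almost
  everywhere.\<close>

lemma (in borel_sigma_finite) corr_fun_AE:
  assumes f: "case_prod (mayer v) \<in> borel_measurable (borel \<Otimes>\<^sub>M borel)" and sym: "\<And>x y. v x y = v y x"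
    and h: "h \<in> borel_measurable borel" "\<And>x. 0 \<le> h x"
    and D: "borel_sigma_finite (density M h)" and L: "lamzL M z L = density M h"
    and \<rho>: "is_corr_fun M z v L n \<rho>"
  shows "AE x in PiM {..<n} (\<lambda>_. M). \<rho> x = ennreal (\<Prod>i<n. h (x i)) *
        (poisson_int (density M h) (\<lambda>ys. ennreal (boltzmann (mayer v) (map x [0..<n] @ ys))) /
         poisson_int (density M h) (\<lambda>ys. ennreal (boltzmann (mayer v) ys)))"
proof -
  interpret D: repulsive_gas "density M h" "mayer v" by (rule repulsive_gas_mayer[OF D f sym])
  interpret P: product_sigma_finite "\<lambda>_::nat. M" ..
  interpret S: sigma_finite_measure "PiM {..<n} (\<lambda>_::nat. M)" by (rule P.sigma_finite) simp
  note [measurable] = h(1)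
  have [measurable]: "(\<lambda>x. map x [0..<n]) \<in> measurable (PiM {..<n} (\<lambda>_. M)) list_borel"
    by (rule measurable_map_list) auto
  show ?thesis
  proof (rule S.density_unique2)
    show "\<rho> \<in> borel_measurable (PiM {..<n} (\<lambda>_. M))" using \<rho> by (simp add: is_corr_fun_def)
    fix A assume "A \<in> sets (PiM {..<n} (\<lambda>_. M))"
    then have ind: "indicator A \<in> borel_measurable (PiM {..<n} (\<lambda>_. M))" by simp
    from \<rho> ind have "gibbs_expect M z v L (\<lambda>m x. factsum n m (indicator A) x)
        = (\<integral>\<^sup>+ x. indicator A x * \<rho> x \<partial>PiM {..<n} (\<lambda>_. M))"
      unfolding is_corr_fun_def by blast
    then show "(\<integral>\<^sup>+x\<in>A. \<rho> x \<partial>PiM {..<n} (\<lambda>_. M)) = (\<integral>\<^sup>+x\<in>A. ennreal (\<Prod>i<n. h (x i)) *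
        (poisson_int (density M h) (\<lambda>ys. ennreal (boltzmann (mayer v) (map x [0..<n] @ ys))) /
         poisson_int (density M h) (\<lambda>ys. ennreal (boltzmann (mayer v) ys))) \<partial>PiM {..<n} (\<lambda>_. M))"
      unfolding gibbs_expect_factsum[OF f sym h D L ind] by (simp add: mult.commute)
  qed measurable
qed


theorem mainTheorem6:
  fixes lam :: "'a::polish_space measure"
    and v :: "'a \<Rightarrow> 'a \<Rightarrow> ennreal"
    and z :: "'a \<Rightarrow> real"
    and a :: "'a \<Rightarrow> real"
  assumes lam_sets: "sets lam = sets borel"
    and lam_fin: "\<And>B. B \<in> sets borel \<Longrightarrow> bounded B \<Longrightarrow> emeasure lam B < \<infinity>"
    and v_meas: "(\<lambda>p. v (fst p) (snd p)) \<in> borel_measurable (lam \<Otimes>\<^sub>M lam)"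
    and v_sym: "\<And>x y. v x y = v y x"
    and z_meas: "z \<in> borel_measurable lam"
    and z_nonneg: "\<And>x. z x \<ge> 0"
    and z_loc: "\<And>B. B \<in> sets borel \<Longrightarrow> bounded B \<Longrightarrow> (\<integral>\<^sup>+ x. ennreal (z x) * indicator B x \<partial>lam) < \<infinity>"
    and a_meas: "a \<in> borel_measurable lam"
    and a_nonneg: "\<And>x. a x \<ge> 0"
    and KP: "AE x0 in lam.
       (\<Sum>k. ennreal (1 / fact (Suc k)) *
          (\<integral>\<^sup>+ y. ennreal ((\<Prod>j<Suc k. \<bar>mayer v x0 (y j)\<bar>)
                 * (\<Prod>(i, j)\<in>{(i, j). i < j \<and> j < Suc k}. 1 + mayer v (y i) (y j))
                 * (\<Prod>j<Suc k. z (y j) * exp (a (y j))))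
             \<partial>PiM {..<Suc k} (\<lambda>_. lam)))
       \<le> ennreal (exp (a x0) - 1)"
  shows "\<forall>n\<ge>1.
      (AE x in PiM {..<n} (\<lambda>_. lam).
         ennreal \<bar>psi v n n x\<bar>
         + (\<Sum>k. ennreal (1 / fact (Suc k)) *
              (\<integral>\<^sup>+ y. ennreal \<bar>psi v n (n + Suc k) (app n x y)\<bar>
                 \<partial>PiM {..<Suc k} (\<lambda>_. lamz lam z)))
         \<le> ennreal ((\<Prod>(i, j)\<in>{(i, j). i < j \<and> j < n}. 1 + mayer v (x i) (x j))
                    * exp (\<Sum>i<n. a (x i))))
      \<and> (\<forall>L \<rho>. L \<in> sets borel \<longrightarrow> bounded L \<longrightarrow> emeasure (lamz lam z) L > 0 \<longrightarrow>
            is_corr_fun lam z v L n \<rho> \<longrightarrow>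
            (AE x in PiM {..<n} (\<lambda>_. lam). (\<forall>i<n. x i \<in> L) \<longrightarrow>
               \<rho> x \<noteq> \<infinity> \<and>
               enn2real (\<rho> x) = (\<Prod>j<n. z (x j)) *
                 (psi v n n x
                  + (\<Sum>k. 1 / fact (Suc k) *
                      (\<integral>y. psi v n (n + Suc k) (app n x y)
                         \<partial>PiM {..<Suc k} (\<lambda>_. lamzL lam z L))))))"
proof (intro allI impI conjI)
  fix n :: nat
  let ?zL = "\<lambda>L x. z x * indicator L x"
  let ?xs = "\<lambda>x :: nat \<Rightarrow> 'a. map x [0..<n]"
  interpret lam: borel_sigma_finite lam
    using lam_sets lam_fin by (rule borel_sigma_finite_bounded)
  have z [measurable]: "z \<in> borel_measurable borel" and a [measurable]: "a \<in> borel_measurable borel"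
    using z_meas a_meas by (simp_all add: measurable_cong_sets[OF lam_sets refl])
  have f: "case_prod (mayer v) \<in> borel_measurable (borel \<Otimes>\<^sub>M borel)"
    using v_meas by (rule lam.borel_measurable_mayer)
  have D: "borel_sigma_finite (density lam z)"
  proof (rule borel_sigma_finite_bounded)
    fix B :: "'a set" assume B: "B \<in> sets borel" "bounded B"
    then show "emeasure (density lam z) B < \<infinity>"
      using z_loc[OF B] by (simp add: emeasure_density lam_sets)
  qed (simp add: lam_sets)
  interpret D: repulsive_gas "density lam z" "mayer v"
    by (rule repulsive_gas_mayer[OF D f v_sym])
  \<comment> \<open>The good points are fixed before any configuration is considered, so the bound
    holds at every root list with entries in \<open>G\<close>, whatever its length.\<close>
  define G where "G = {x. poisson_int (density lam z) (\<lambda>ys. ennreal ((\<Prod>y\<leftarrow>ys. \<bar>mayer v x y\<bar>) *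
      boltzmann (mayer v) ys * (\<Prod>y\<leftarrow>ys. exp (a y)))) \<le> ennreal (exp (a x))}"
  have G: "AE x in lam. x \<in> G"
    using KP unfolding G_def mem_Collect_eq
    by eventually_elim (rule lam.poisson_int_kp[OF f v_sym z z_nonneg a a_nonneg D], simp add: weight_def)
  \<comment> \<open>The measure with density \<open>z\<close> is absolutely continuous, so
    integration over non-roots avoids the complement of \<open>G\<close> as well.\<close>
  have GD: "AE x in density lam z. x \<in> G"
    using G by (subst AE_density) auto
  have bound: "poisson_int (density lam z) (\<lambda>ys. ennreal \<bar>rooted (mayer v) xs ys\<bar>)
      \<le> ennreal (boltzmann (mayer v) xs * (\<Prod>x\<leftarrow>xs. exp (a x)))" if "set xs \<subseteq> G" for xs
    by (rule D.poisson_int_rooted_le[OF a GD _ that]) (simp add: G_def)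
  have GP: "AE x in PiM {..<n} (\<lambda>_. lam). \<forall>i<n. x i \<in> G"
    by (rule lam.AE_PiM_all[OF G])
  \<comment> \<open>Without non-roots every graph is admissible, and the graph sum is the full
    product of the factors 1 + f.\<close>
  have psi_nn: "psi v n n x = boltzmann (mayer v) (?xs x)" for x
    using psi_eq_rooted[of v n 0 x, OF v_sym] by (simp add: rooted_Nil2)
  show "AE x in PiM {..<n} (\<lambda>_. lam).
         ennreal \<bar>psi v n n x\<bar>
         + (\<Sum>k. ennreal (1 / fact (Suc k)) *
              (\<integral>\<^sup>+ y. ennreal \<bar>psi v n (n + Suc k) (app n x y)\<bar>
                 \<partial>PiM {..<Suc k} (\<lambda>_. lamz lam z)))
         \<le> ennreal ((\<Prod>(i, j)\<in>{(i, j). i < j \<and> j < n}. 1 + mayer v (x i) (x j))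
                    * exp (\<Sum>i<n. a (x i)))"
    using GP
  proof eventually_elim
    fix x assume x: "\<forall>i<n. x i \<in> G"
    have int: "(\<integral>\<^sup>+ y. ennreal \<bar>psi v n (n + k) (app n x y)\<bar> \<partial>PiM {..<k} (\<lambda>_. lamz lam z))
        = iter_int (density lam z) k (\<lambda>ys. ennreal \<bar>rooted (mayer v) (?xs x) ys\<bar>)" for k
      unfolding psi_app[of v, OF v_sym] lamz_def by (rule D.iter_int_eq_PiM[symmetric]) measurable
    have "ennreal \<bar>psi v n n x\<bar> + (\<Sum>k. ennreal (1 / fact (Suc k)) *
              (\<integral>\<^sup>+ y. ennreal \<bar>psi v n (n + Suc k) (app n x y)\<bar> \<partial>PiM {..<Suc k} (\<lambda>_. lamz lam z)))
        = poisson_int (density lam z) (\<lambda>ys. ennreal \<bar>rooted (mayer v) (?xs x) ys\<bar>)"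
      unfolding int poisson_int_head psi_nn rooted_Nil2 ..
    also have "\<dots> \<le> ennreal (boltzmann (mayer v) (?xs x) * (\<Prod>x\<leftarrow>?xs x. exp (a x)))"
      by (rule bound) (use x in auto)
    also have "\<dots> = ennreal (weight v n x * exp (\<Sum>i<n. a (x i)))"
      by (simp only: weight_eq_boltzmann[of v, OF v_sym] prod_list_map_upt exp_sum finite_lessThan)
    finally show "ennreal \<bar>psi v n n x\<bar>
         + (\<Sum>k. ennreal (1 / fact (Suc k)) *
              (\<integral>\<^sup>+ y. ennreal \<bar>psi v n (n + Suc k) (app n x y)\<bar>
                 \<partial>PiM {..<Suc k} (\<lambda>_. lamz lam z)))
         \<le> ennreal ((\<Prod>(i, j)\<in>{(i, j). i < j \<and> j < n}. 1 + mayer v (x i) (x j))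
                    * exp (\<Sum>i<n. a (x i)))"
      unfolding weight_def .
  qed
  fix L \<rho>
  assume L [measurable]: "L \<in> sets borel" and bL: "bounded L" and \<rho>: "is_corr_fun lam z v L n \<rho>"
  have h: "?zL L \<in> borel_measurable borel" "\<And>x. 0 \<le> ?zL L x" "\<And>x. ?zL L x \<le> z x"
    using z_nonneg by (auto simp: indicator_def)
  have lamzL: "lamzL lam z L = density lam (?zL L)"
    unfolding lamzL_def by (intro arg_cong[where f = "density lam"]) (auto simp: indicator_def fun_eq_iff)
  \<comment> \<open>Boundedness of \<open>L\<close> makes the restricted measure finite, and with it
    the partition function.\<close>
  have "emeasure (density lam (?zL L)) UNIV = (\<integral>\<^sup>+ x. ennreal (z x) * indicator L x \<partial>lam)"
    using h(1) by (subst emeasure_density) (auto simp: indicator_def lam_sets intro!: nn_integral_cong)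
  with z_loc[OF L bL] have fin: "emeasure (density lam (?zL L)) UNIV < \<infinity>" by simp
  interpret E: finite_measure "density lam (?zL L)"
    by (rule finite_measureI) (use fin in simp)
  have E: "borel_sigma_finite (density lam (?zL L))"
    by unfold_locales (simp add: lam_sets)
  interpret E: repulsive_gas "density lam (?zL L)" "mayer v"
    by (rule repulsive_gas_mayer[OF E f v_sym])
  have Z: "poisson_int (density lam (?zL L)) (\<lambda>ys. ennreal (boltzmann (mayer v) ys)) < \<top>"
    using E.boltz01 by (intro poisson_int_finite E.finite_measure_axioms) simp
  have corr: "AE x in PiM {..<n} (\<lambda>_. lam). \<rho> x = ennreal (\<Prod>i<n. ?zL L (x i)) *
        (poisson_int (density lam (?zL L)) (\<lambda>ys. ennreal (boltzmann (mayer v) (?xs x @ ys))) /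
         poisson_int (density lam (?zL L)) (\<lambda>ys. ennreal (boltzmann (mayer v) ys)))"
    by (rule lam.corr_fun_AE[OF f v_sym h(1,2) E lamzL \<rho>])
  show "AE x in PiM {..<n} (\<lambda>_. lam). (\<forall>i<n. x i \<in> L) \<longrightarrow>
               \<rho> x \<noteq> \<infinity> \<and>
               enn2real (\<rho> x) = (\<Prod>j<n. z (x j)) *
                 (psi v n n x
                  + (\<Sum>k. 1 / fact (Suc k) *
                      (\<integral>y. psi v n (n + Suc k) (app n x y)
                         \<partial>PiM {..<Suc k} (\<lambda>_. lamzL lam z L))))"
    using corr GP
  proof eventually_elim
    fix x
    assume \<rho>x: "\<rho> x = ennreal (\<Prod>i<n. ?zL L (x i)) *
        (poisson_int (density lam (?zL L)) (\<lambda>ys. ennreal (boltzmann (mayer v) (?xs x @ ys))) /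
         poisson_int (density lam (?zL L)) (\<lambda>ys. ennreal (boltzmann (mayer v) ys)))"
      and x: "\<forall>i<n. x i \<in> G"
    \<comment> \<open>Absolute convergence over \<open>L\<close> is inherited from the whole space,
      since restricting only decreases the activity.\<close>
    have "poisson_int (density lam (?zL L)) (\<lambda>ys. ennreal \<bar>rooted (mayer v) (?xs x) ys\<bar>)
        \<le> poisson_int (density lam z) (\<lambda>ys. ennreal \<bar>rooted (mayer v) (?xs x) ys\<bar>)"
      by (rule lam.poisson_int_density_mono[OF h(1,2) z h(3) _ E D]) measurable
    also have "\<dots> \<le> ennreal (boltzmann (mayer v) (?xs x) * (\<Prod>x\<leftarrow>?xs x. exp (a x)))"
      by (rule bound) (use x in auto)
    also have "\<dots> < \<top>" by simp
    finally have R: "poisson_int (density lam (?zL L)) (\<lambda>ys. ennreal \<bar>rooted (mayer v) (?xs x) ys\<bar>) < \<top>" .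
    show "(\<forall>i<n. x i \<in> L) \<longrightarrow>
               \<rho> x \<noteq> \<infinity> \<and>
               enn2real (\<rho> x) = (\<Prod>j<n. z (x j)) *
                 (psi v n n x
                  + (\<Sum>k. 1 / fact (Suc k) *
                      (\<integral>y. psi v n (n + Suc k) (app n x y)
                         \<partial>PiM {..<Suc k} (\<lambda>_. lamzL lam z L))))"
    proof
      assume "\<forall>i<n. x i \<in> L"
      \<comment> \<open>At points of \<open>L\<close> the indicators equal 1, so the prefactor is
        the product of the activities; the other factor is the quotient evaluated by
        \<open>boltzmann_ratio\<close>.\<close>
      then have "(\<Prod>i<n. ?zL L (x i)) = (\<Prod>j<n. z (x j))" by (intro prod.cong) auto
      moreover have "0 \<le> (\<Prod>j<n. z (x j))" using z_nonneg by (intro prod_nonneg) auto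
      ultimately show "\<rho> x \<noteq> \<infinity> \<and>
               enn2real (\<rho> x) = (\<Prod>j<n. z (x j)) *
                 (psi v n n x
                  + (\<Sum>k. 1 / fact (Suc k) *
                      (\<integral>y. psi v n (n + Suc k) (app n x y)
                         \<partial>PiM {..<Suc k} (\<lambda>_. lamzL lam z L))))"
        unfolding \<rho>x psi_app[of v, OF v_sym] psi_nn lamzL
        using E.boltzmann_ratio[OF Z R]
        by (simp add: enn2real_mult ennreal_mult_eq_top_iff del: fact_Suc upt_Suc)
    qed
  qed
qed

end
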